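(* Let $g:(0,\infty)^{n}\to\mathbb{R}$ be a continuous symmetric function and let $h:\mathbb{R}^{n}\to\mathbb{R}$, $h(x)=g(\exp x_1,\dots,\exp x_n)$. Let $p$ be the function defined by $$p\left(x^{\downarrow}_{1},\ x^{\downarrow}_{1}+x^{\downarrow}_{2},\ \dots,\ \sum_{i=1}^{n}x^{\downarrow}_{i}\right)=h(x_1,\dots,x_n),\qquad x\in\mathbb{R}^n .$$ Suppose that: (a) $h$ is convex, (b) $p$ is nonincreasing in each argument. Let $\Omega\subset\mathbb{R}^{n}$ be a bounded open set with piecewise smooth boundary and let $\phi:\overline{\Omega}\to\mathbb{R}^{n}$ be any Lipschitz function such that $D\phi(x)\in GL(n,\mathbb{R})^{+}$ for almost every $x\in\Omega$ and $\phi(x)=x$ on $\partial\Omega$. Define $$w:GL(n,\mathbb{R})^{+}\to\mathbb{R},\qquad w(F)=g(\sigma(F)).$$ Then for any $F\in GL(n,\mathbb{R})^{+}$, $$\int_{\Omega}w(F\,D\phi(x))\,dx\ \geq\ |\Omega|\,w(F).$$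
   Context: $GL(n,\mathbb{R})^{+}$ is the set of real $n\times n$ matrices with positive determinant; $\sigma(F)$ is the vector of singular values of $F$ (eigenvalues of the square root of $F^TF$, with multiplicity); $|\Omega|$ is the Lebesgue measure of $\Omega$. For $x\in\mathbb{R}^n$, $x^{\downarrow}=(x^{\downarrow}_1,\dots,x^{\downarrow}_n)$ is the vector obtained by rearranging the coordinates of $x$ in decreasing order. A function on $(0,\infty)^n$ is symmetric if it is invariant under all permutations of coordinates. The function $p$ is well defined on the set of vectors of partial sums $\{(\sum_{i=1}^{k}x^{\downarrow}_i)_{k=1,\dots,n}: x\in\mathbb{R}^n\}$; "nonincreasing in each argument" means that if two vectors $s,s'$ of this set differ only in one coordinate $k$ and $s_k\le s'_k$, then $p(s)\ge p(s')$. *)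

theory Defs
  imports "HOL-Analysis.Analysis"
begin

section \<open>Rearrangement and partial sums\<close>

definition decreasing_rearrangement :: "real ^ 'n \<Rightarrow> real list" where
  "decreasing_rearrangement x = rev (sorted_list_of_multiset (image_mset (($) x) (mset_set UNIV)))"

text \<open>Entry number \<open>k\<close> (counted from 0) of \<open>partial_sums x\<close> is the sum of the
  \<open>k + 1\<close> largest coordinates of \<open>x\<close>; the list has length \<open>CARD('n)\<close>.\<close>

definition partial_sums :: "real ^ 'n \<Rightarrow> real list" where
  "partial_sums x =
     map (\<lambda>k. sum_list (take (Suc k) (decreasing_rearrangement x))) [0..<CARD('n)]"

definition nonincreasing_in_each_argument :: "real list set \<Rightarrow> (real list \<Rightarrow> real) \<Rightarrow> bool" where
  "nonincreasing_in_each_argument S p \<longleftrightarrow>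
     (\<forall>s\<in>S. \<forall>s'\<in>S. \<forall>k<length s.
        length s' = length s \<longrightarrow> (\<forall>j<length s. j \<noteq> k \<longrightarrow> s' ! j = s ! j) \<longrightarrow> s ! k \<le> s' ! k \<longrightarrow>
        p s' \<le> p s)"

section \<open>Symmetric functions on the positive orthant\<close>

definition positive_orthant :: "(real ^ 'n) set" where
  "positive_orthant = {x. \<forall>i. 0 < x $ i}"

definition symmetric_on_orthant :: "(real ^ 'n \<Rightarrow> 'a) \<Rightarrow> bool" where
  "symmetric_on_orthant g \<longleftrightarrow>
     (\<forall>\<pi>. \<pi> permutes UNIV \<longrightarrow> (\<forall>x\<in>positive_orthant. g (\<chi> i. x $ \<pi> i) = g x))"

section \<open>Matrices and singular values\<close>

definition GL_plus :: "(real ^ 'n ^ 'n) set" where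
  "GL_plus = {F. 0 < det F}"

definition psd_sqrt :: "real ^ 'n ^ 'n \<Rightarrow> real ^ 'n ^ 'n" where
  "psd_sqrt A = (THE S. transpose S = S \<and> (\<forall>v. 0 \<le> v \<bullet> (S *v v)) \<and> S ** S = A)"

text \<open>\<open>s\<close> lists all eigenvalues of \<open>S\<close>, each as often as its multiplicity as a root of the
  characteristic polynomial.\<close>

definition lists_eigenvalues :: "real ^ 'n ^ 'n \<Rightarrow> real ^ 'n \<Rightarrow> bool" where
  "lists_eigenvalues S s \<longleftrightarrow> (\<forall>t. det (mat t - S) = (\<Prod>i\<in>UNIV. t - s $ i))"

text \<open>The index type carries no order, so the singular values are listed in an unspecified
  order; only symmetric functions of them are meaningful.\<close>

definition singular_values :: "real ^ 'n ^ 'n \<Rightarrow> real ^ 'n" where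
  "singular_values F = (SOME s. lists_eigenvalues (psd_sqrt (transpose F ** F)) s)"

section \<open>Piecewise smooth boundary\<close>

text \<open>Smooth means continuously differentiable, as in the library's treatment of smooth paths.
  A hypersurface is locally the zero set of a continuously differentiable function with
  nonvanishing gradient.\<close>

definition smooth_hypersurface :: "(real ^ 'n) set \<Rightarrow> bool" where
  "smooth_hypersurface M \<longleftrightarrow>
     (\<forall>x\<in>M. \<exists>U f G. open U \<and> x \<in> U \<and> continuous_on U G \<and>
        (\<forall>y\<in>U. ((f :: real ^ 'n \<Rightarrow> real) has_derivative (\<lambda>v. G y \<bullet> v)) (at y) \<and> G y \<noteq> 0) \<and>
        M \<inter> U = {y\<in>U. f y = 0})"

text \<open>For compact \<open>N\<close>, to which it is applied below, this says that the Hausdorff measure of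
  \<open>N\<close> in dimension \<open>CARD('n) - 1\<close> is zero. If \<open>CARD('n) = 1\<close>, then only the empty set
  qualifies.\<close>

definition codim1_null :: "(real ^ 'n) set \<Rightarrow> bool" where
  "codim1_null N \<longleftrightarrow>
     (\<forall>\<epsilon>>0. \<exists>C :: ((real ^ 'n) \<times> real) set. finite C \<and> (\<forall>(a, r)\<in>C. 0 < r) \<and>
        N \<subseteq> (\<Union>(a, r)\<in>C. ball a r) \<and> (\<Sum>(a, r)\<in>C. r ^ (CARD('n) - 1)) < \<epsilon>)"

text \<open>The boundary is the union of the closures of finitely many connected smooth pieces, and the
  points at which it is not smooth (edges, corners, cusps, conical points) form a set of
  lower dimension. Neither a Lipschitz condition nor smoothness of the pieces up to their edges is
  required.\<close>

definition piecewise_smooth_boundary :: "(real ^ 'n) set \<Rightarrow> bool" where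
  "piecewise_smooth_boundary \<Omega> \<longleftrightarrow>
     (\<exists>\<M>. finite \<M> \<and>
        (\<forall>M\<in>\<M>. smooth_hypersurface M \<and> connected M \<and> openin (top_of_set (frontier \<Omega>)) M) \<and>
        frontier \<Omega> = (\<Union>M\<in>\<M>. closure M) \<and>
        codim1_null (frontier \<Omega> - \<Union>\<M>))"

section \<open>Integrals with values in the extended reals\<close>

text \<open>The integrand of the theorem may fail to be integrable when the determinant of the derivative
  comes close to zero; the Bochner integral would then be 0 by convention. Hence the integral is
  taken as the difference of the integrals of the positive and the negative part. The coercion
  \<open>ennreal\<close> maps negative numbers to 0. Without \<open>extended_integral_exists\<close> the
  difference below can be \<open>\<infinity> - \<infinity>\<close>, which is \<open>\<infinity>\<close> in the library.\<close>

definition extended_integral_exists :: "'a measure \<Rightarrow> ('a \<Rightarrow> real) \<Rightarrow> bool" where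
  "extended_integral_exists M f \<longleftrightarrow> f \<in> borel_measurable M \<and>
     ((\<integral>\<^sup>+ x. ennreal (f x) \<partial>M) < \<infinity> \<or> (\<integral>\<^sup>+ x. ennreal (- f x) \<partial>M) < \<infinity>)"

definition extended_integral :: "'a measure \<Rightarrow> ('a \<Rightarrow> real) \<Rightarrow> ereal" where
  "extended_integral M f =
     enn2ereal (\<integral>\<^sup>+ x. ennreal (f x) \<partial>M) - enn2ereal (\<integral>\<^sup>+ x. ennreal (- f x) \<partial>M)"

end

theory Submission
  imports Defs "HOL-Computational_Algebra.Polynomial"
begin

text \<open>
  The two assumptions on \<open>h\<close> pull in opposite directions. A convex symmetric function of \<open>x\<close>
  cannot increase when \<open>x\<close> is replaced by an average of its rearrangements, whereas such an
  averaging lowers the partial sums of the decreasing rearrangement, so that by monotonicity of \<open>p\<close>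
  it cannot decrease \<open>h\<close>. Hence \<open>h\<close> depends only on the sum of the coordinates
  (lemma \<open>h_eq_profile\<close>): \<open>h x = k (x\<^sub>1 + \<dots> + x\<^sub>n)\<close> with \<open>k\<close> convex and nonincreasing.
  The product of the singular values of a matrix of positive determinant is its determinant,
  therefore \<open>w A = k (ln (det A))\<close>.

  Let \<open>m \<le> 0\<close> be a subgradient of \<open>k\<close> at \<open>ln (det F)\<close>. From \<open>ln t \<le> t - 1\<close> follows the affine lower
  bound \<open>w (F ** A) \<ge> w F + m * (det A - 1)\<close>. With \<open>A\<close> the Jacobian matrix of \<open>\<phi>\<close>, integration over
  \<open>\<Omega>\<close> gives the theorem, because the integral of the Jacobian determinant of \<open>\<phi>\<close> over \<open>\<Omega>\<close> is the
  measure of \<open>\<Omega>\<close> (lemma \<open>integral_det_jacobian\<close>).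

  The last fact is proved by a deformation to the identity. Put \<open>u = \<phi> - id\<close> on \<open>\<Omega>\<close> and \<open>u = 0\<close>
  elsewhere, a Lipschitz function. For small \<open>t > 0\<close> the map \<open>id + t u\<close> is a Lipschitz bijection of the
  space by the contraction principle; it fixes the complement of \<open>\<Omega>\<close> pointwise, so it maps \<open>\<Omega>\<close> onto
  itself, and the change of variables formula shows that the integral of \<open>det (1 + t Du)\<close> over \<open>\<Omega>\<close> is
  the measure of \<open>\<Omega>\<close>. This integral is a polynomial in \<open>t\<close>. Being constant for small \<open>t\<close>, it is
  constant, and \<open>t = 1\<close> is the claim.
\<close>

section \<open>Symmetric matrices and singular values\<close>

lemma inner_matrix_vector_mult:
  fixes M :: "real ^ 'n ^ 'm"
  shows "x \<bullet> (M *v y) = (transpose M *v x) \<bullet> y"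
  by (simp add: transpose_matrix_vector dot_lmul_matrix)

lemma symmetric_matrix_inner:
  fixes S :: "real ^ 'n ^ 'n"
  assumes "transpose S = S"
  shows "x \<bullet> (S *v y) = (S *v x) \<bullet> y"
  using inner_matrix_vector_mult[of x S y] assms by simp

text \<open>A maximiser \<open>v\<close> of the Rayleigh quotient on the unit sphere of \<open>V\<close> is an eigenvector. The form
  \<open>l * (x \<bullet> x) - x \<bullet> (S *v x)\<close>, with \<open>l\<close> the maximum, is nonnegative on \<open>V\<close> and vanishes at \<open>v\<close>;
  moving from \<open>v\<close> in the direction of the residual \<open>w = l *\<^sub>R v - S *v v\<close> would make it negative
  unless \<open>w = 0\<close>.\<close>

lemma symmetric_matrix_eigenvector_in_subspace:
  fixes S :: "real ^ 'n ^ 'n"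
  assumes sym: "transpose S = S" and V: "subspace V"
    and inv: "\<And>v. v \<in> V \<Longrightarrow> S *v v \<in> V" and ne: "u \<in> V" "u \<noteq> 0"
  obtains v l where "v \<in> V" "norm v = 1" "S *v v = l *\<^sub>R v"
proof -
  let ?K = "V \<inter> sphere 0 1"
  have "compact ?K"
    using V closed_Int_compact closed_subspace compact_sphere by blast
  moreover have "(1 / norm u) *\<^sub>R u \<in> ?K"
    using V ne by (simp add: subspace_scale)
  moreover have "continuous_on ?K (\<lambda>v. v \<bullet> (S *v v))"
    by (intro continuous_intros linear_continuous_on_compose[OF continuous_on_id])
       (simp add: matrix_vector_mul_linear)
  ultimately obtain v where v: "v \<in> ?K" and max: "\<And>u. u \<in> ?K \<Longrightarrow> u \<bullet> (S *v u) \<le> v \<bullet> (S *v v)"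
    using continuous_attains_sup[of ?K "\<lambda>v. v \<bullet> (S *v v)"] by blast
  define l where "l = v \<bullet> (S *v v)"
  have quad: "x \<bullet> (S *v x) \<le> l * (x \<bullet> x)" if "x \<in> V" for x
  proof (cases "x = 0")
    case False
    let ?y = "(1 / norm x) *\<^sub>R x"
    have "?y \<in> ?K"
      using False V that by (simp add: subspace_scale)
    then have "?y \<bullet> (S *v ?y) \<le> l"
      unfolding l_def by (rule max)
    moreover have "?y \<bullet> (S *v ?y) = (x \<bullet> (S *v x)) / (x \<bullet> x)"
      using False by (simp only: matrix_vector_mult_scaleR inner_scaleR_left inner_scaleR_right dot_square_norm)
        (simp add: power2_eq_square field_simps)
    ultimately have "(x \<bullet> (S *v x)) / (x \<bullet> x) \<le> l"
      by (simp only:)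
    then show ?thesis
      using False by (simp only: pos_divide_le_eq inner_gt_zero_iff not_False_eq_True)
  qed simp
  define w where "w = l *\<^sub>R v - S *v v"
  have w: "w \<in> V"
    using v V inv by (simp add: w_def subspace_diff subspace_scale)
  define b where "b = l * (w \<bullet> w) - w \<bullet> (S *v w)"
  have b: "0 \<le> b"
    using quad[OF w] by (simp add: b_def)
  \<comment> \<open>The form at \<open>v + t *\<^sub>R w\<close> is \<open>2 * t * (w \<bullet> w) + t\<^sup>2 * b\<close>. The minimum would be at
    \<open>- (w \<bullet> w) / b\<close>; the denominator \<open>b + 1\<close> also covers \<open>b = 0\<close>.\<close>
  define t where "t = - (w \<bullet> w) / (b + 1)"
  have "v + t *\<^sub>R w \<in> V"
    using v w V by (simp add: subspace_add subspace_scale)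
  then have "0 \<le> l * ((v + t *\<^sub>R w) \<bullet> (v + t *\<^sub>R w)) - (v + t *\<^sub>R w) \<bullet> (S *v (v + t *\<^sub>R w))"
    using quad by simp
  also have "\<dots> = 2 * t * (w \<bullet> w) + t\<^sup>2 * b"
  proof -
    have 1: "v \<bullet> (S *v w) = w \<bullet> (S *v v)"
      using symmetric_matrix_inner[OF sym, of v w] by (simp add: inner_commute)
    have 2: "w \<bullet> w = l * (v \<bullet> w) - w \<bullet> (S *v v)"
      by (subst (2) w_def) (simp add: inner_diff_right inner_commute[of w v])
    have 3: "v \<bullet> v = 1"
      using v by (simp add: dot_square_norm)
    have "l * ((v + t *\<^sub>R w) \<bullet> (v + t *\<^sub>R w)) - (v + t *\<^sub>R w) \<bullet> (S *v (v + t *\<^sub>R w))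
        = (l * (v \<bullet> v) - v \<bullet> (S *v v)) + 2 * t * (l * (v \<bullet> w) - w \<bullet> (S *v v)) + t\<^sup>2 * b"
      by (simp add: b_def matrix_vector_right_distrib matrix_vector_mult_scaleR inner_add_left inner_add_right 1
          inner_commute[of w v] algebra_simps power2_eq_square)
    also have "\<dots> = 2 * t * (w \<bullet> w) + t\<^sup>2 * b"
      unfolding 3 2[symmetric] l_def[symmetric] by simp
    finally show ?thesis .
  qed
  also have "\<dots> \<le> - ((w \<bullet> w)\<^sup>2 / (b + 1))"
  proof -
    have "t\<^sup>2 * b \<le> t\<^sup>2 * (b + 1)"
      by (simp add: mult_left_mono)
    also have "\<dots> = (w \<bullet> w)\<^sup>2 / (b + 1)"
      using b by (simp add: t_def power2_eq_square)
    finally show ?thesis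
      by (simp add: t_def power2_eq_square)
  qed
  finally have "(w \<bullet> w)\<^sup>2 / (b + 1) \<le> 0"
    by simp
  then have "(w \<bullet> w)\<^sup>2 \<le> 0"
    using b by (simp add: divide_le_0_iff)
  then have "w = 0" by simp
  then show thesis
    using that[of v l] v by (simp add: w_def)
qed

text \<open>The orthogonal complement of a set of eigenvectors is invariant under a symmetric matrix, so as
  long as there are fewer than \<open>CARD('n)\<close> of them the complement contains a further one.\<close>

lemma symmetric_matrix_orthonormal_eigenvectors:
  fixes S :: "real ^ 'n ^ 'n"
  assumes sym: "transpose S = S" and "k \<le> CARD('n)"
  shows "\<exists>B. finite B \<and> card B = k \<and> pairwise orthogonal B \<and>
           (\<forall>b\<in>B. norm b = 1 \<and> (\<exists>l. S *v b = l *\<^sub>R b))"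
  using \<open>k \<le> CARD('n)\<close>
proof (induction k)
  case 0
  show ?case by (rule exI[of _ "{}"]) auto
next
  case (Suc k)
  then obtain B where B: "finite B" "card B = k" "pairwise orthogonal B"
    and eig: "\<And>b. b \<in> B \<Longrightarrow> norm b = 1" "\<And>b. b \<in> B \<Longrightarrow> \<exists>l. S *v b = l *\<^sub>R b"
    by auto
  have "dim B < DIM(real ^ 'n)"
    using dim_le_card'[OF B(1)] B(2) Suc.prems by simp
  then obtain u where u: "u \<noteq> 0" "\<And>y. y \<in> span B \<Longrightarrow> orthogonal u y"
    by (rule orthogonal_to_subspace_exists) blast
  let ?V = "{x. \<forall>b\<in>B. b \<bullet> x = 0}"
  have uV: "u \<in> ?V"
    using u(2) span_base by (fastforce simp: orthogonal_def inner_commute)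
  have sub: "subspace ?V"
    by (auto simp: subspace_def inner_add_right)
  have inv: "S *v v \<in> ?V" if "v \<in> ?V" for v
  proof -
    have "b \<bullet> (S *v v) = 0" if "b \<in> B" for b
      using eig(2)[OF that] \<open>v \<in> ?V\<close> that by (auto simp: symmetric_matrix_inner[OF sym])
    then show ?thesis by simp
  qed
  obtain v l where v: "v \<in> ?V" "norm v = 1" "S *v v = l *\<^sub>R v"
    using symmetric_matrix_eigenvector_in_subspace[OF sym sub inv uV u(1)] by blast
  have "v \<notin> B"
    using v(1,2) by (auto simp: dot_square_norm)
  moreover have "pairwise orthogonal (insert v B)"
    unfolding pairwise_insert using B(3) v(1) by (simp add: orthogonal_def inner_commute)
  ultimately show ?case
    using B eig v by (intro exI[of _ "insert v B"]) auto
qed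

definition diagonal_matrix :: "('n \<Rightarrow> real) \<Rightarrow> real ^ 'n ^ 'n" where
  "diagonal_matrix d = (\<chi> i j. if i = j then d i else 0)"

lemma diagonal_matrix_vector_mult: "diagonal_matrix d *v x = (\<chi> i. d i * x $ i)"
  by (simp add: diagonal_matrix_def matrix_vector_mult_def vec_eq_iff if_distrib if_distribR
      cong: if_cong)

lemma diagonal_matrix_mult:
  "diagonal_matrix d ** diagonal_matrix e = diagonal_matrix (\<lambda>i. d i * e i)"
  by (simp add: matrix_eq diagonal_matrix_vector_mult mult.assoc flip: matrix_vector_mul_assoc)

lemma transpose_diagonal_matrix: "transpose (diagonal_matrix d) = diagonal_matrix d"
  by (auto simp: diagonal_matrix_def transpose_def vec_eq_iff)

theorem symmetric_matrix_spectral: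
  fixes S :: "real ^ 'n ^ 'n"
  assumes sym: "transpose S = S"
  obtains Q d where "orthogonal_matrix Q" "S = Q ** diagonal_matrix d ** transpose Q"
proof -
  obtain B where B: "finite B" "card B = CARD('n)" "pairwise orthogonal B"
    and eig: "\<forall>b\<in>B. norm b = 1 \<and> (\<exists>l. S *v b = l *\<^sub>R b)"
    using symmetric_matrix_orthonormal_eigenvectors[OF sym order_refl] by blast
  obtain b where b: "bij_betw b (UNIV :: 'n set) B"
    using B by (metis finite finite_same_card_bij)
  have bB: "b i \<in> B" for i
    using b by (auto simp: bij_betw_def)
  then have "\<forall>i. \<exists>l. S *v b i = l *\<^sub>R b i"
    using eig by blast
  then obtain d where "\<forall>i. S *v b i = d i *\<^sub>R b i"
    by (rule choice[THEN exE])
  then have d: "S *v b i = d i *\<^sub>R b i" for i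
    by blast
  define Q :: "real ^ 'n ^ 'n" where "Q = (\<chi> i j. b j $ i)"
  have col: "column j Q = b j" for j
    by (simp add: Q_def column_def)
  have "orthogonal (b i) (b j)" if "i \<noteq> j" for i j
    using B(3) bB b that by (metis UNIV_I bij_betw_imp_inj_on inj_on_contraD pairwise_def)
  then have Q: "orthogonal_matrix Q"
    using eig bB by (simp add: orthogonal_matrix_orthonormal_columns col)
  have "(S ** Q) $ i $ j = (Q ** diagonal_matrix d) $ i $ j" for i j
  proof -
    have "(S ** Q) $ i $ j = (S *v b j) $ i"
      by (simp add: matrix_matrix_mult_def matrix_vector_mult_def Q_def)
    also have "\<dots> = Q $ i $ j * d j"
      by (simp add: d Q_def)
    also have "\<dots> = (Q ** diagonal_matrix d) $ i $ j"
      by (simp add: matrix_matrix_mult_def diagonal_matrix_def if_distrib cong: if_cong)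
    finally show ?thesis .
  qed
  then have "S ** Q = Q ** diagonal_matrix d"
    by (simp add: vec_eq_iff)
  then have "S = Q ** diagonal_matrix d ** transpose Q"
    using Q by (metis matrix_mul_assoc matrix_mul_rid orthogonal_matrix_def)
  then show thesis
    using that Q by blast
qed

lemma transpose_orthogonal_conjugate:
  fixes Q :: "real ^ 'n ^ 'n"
  shows "transpose (Q ** diagonal_matrix d ** transpose Q) = Q ** diagonal_matrix d ** transpose Q"
  by (simp add: matrix_transpose_mul transpose_diagonal_matrix matrix_mul_assoc)

lemma inner_orthogonal_conjugate:
  fixes Q :: "real ^ 'n ^ 'n"
  shows "v \<bullet> ((Q ** diagonal_matrix d ** transpose Q) *v v)
       = (\<Sum>i\<in>UNIV. d i * ((transpose Q *v v) $ i)\<^sup>2)"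
proof -
  have "v \<bullet> ((Q ** diagonal_matrix d ** transpose Q) *v v)
      = (transpose Q *v v) \<bullet> (diagonal_matrix d *v (transpose Q *v v))"
    by (simp only: inner_matrix_vector_mult[of v Q] flip: matrix_vector_mul_assoc)
  then show ?thesis
    by (simp add: diagonal_matrix_vector_mult inner_vec_def power2_eq_square algebra_simps)
qed

lemma det_orthogonal_conjugate:
  fixes Q :: "real ^ 'n ^ 'n"
  assumes Q: "orthogonal_matrix Q"
  shows "det (mat t - Q ** diagonal_matrix d ** transpose Q) = (\<Prod>i\<in>UNIV. t - d i)"
proof -
  have QQ: "Q ** transpose Q = mat 1"
    using Q by (simp add: orthogonal_matrix_def)
  have 1: "(mat t - A) ** B = t *\<^sub>R B - A ** B" for A B :: "real ^ 'n ^ 'n"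
    by (simp add: matrix_eq matrix_vector_mult_diff_rdistrib flip: matrix_vector_mul_assoc)
       (simp add: mat_def matrix_vector_mult_def vec_eq_iff if_distrib if_distribR sum_distrib_left mult.assoc cong: if_cong)
  have "mat t - Q ** diagonal_matrix d ** transpose Q
      = Q ** (mat t - diagonal_matrix d) ** transpose Q"
  proof -
    have "Q ** (mat t - diagonal_matrix d) ** transpose Q
        = Q ** ((mat t - diagonal_matrix d) ** transpose Q)"
      by (simp add: matrix_mul_assoc)
    also have "\<dots> = t *\<^sub>R (Q ** transpose Q) - Q ** diagonal_matrix d ** transpose Q"
      unfolding 1
      by (simp add: matrix_eq matrix_vector_mult_diff_rdistrib matrix_vector_mult_diff_distrib
          scaleR_matrix_vector_assoc[symmetric] matrix_vector_mult_scaleR flip: matrix_vector_mul_assoc)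
    also have "t *\<^sub>R (Q ** transpose Q) = mat t"
      unfolding QQ by (simp add: mat_def vec_eq_iff)
    finally show ?thesis by simp
  qed
  moreover have "det Q * det (transpose Q) = 1"
    using QQ by (metis det_I det_mul)
  ultimately have "det (mat t - Q ** diagonal_matrix d ** transpose Q) = det (mat t - diagonal_matrix d)"
    by (simp add: det_mul)
  also have "\<dots> = (\<Prod>i\<in>UNIV. (mat t - diagonal_matrix d) $ i $ i)"
    by (rule det_diagonal) (simp add: mat_def diagonal_matrix_def)
  finally show ?thesis
    by (simp add: mat_def diagonal_matrix_def)
qed

text \<open>For \<open>D = R - T\<close> one has \<open>R ** D + D ** T = R ** R - T ** T = 0\<close>. Pairing this with an eigenvector
  \<open>v\<close> of \<open>D\<close> for an eigenvalue \<open>d \<noteq> 0\<close> gives \<open>v \<bullet> (R *v v) + v \<bullet> (T *v v) = 0\<close>; both terms are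
  nonnegative, hence both are zero and so is their difference \<open>d * (v \<bullet> v)\<close>. Thus the symmetric
  matrix \<open>D\<close> has no eigenvalue except 0, so it is the zero matrix.\<close>

lemma psd_square_root_unique:
  fixes R T :: "real ^ 'n ^ 'n"
  assumes R: "transpose R = R" "\<And>v. 0 \<le> v \<bullet> (R *v v)"
    and T: "transpose T = T" "\<And>v. 0 \<le> v \<bullet> (T *v v)"
    and eq: "R ** R = T ** T"
  shows "R = T"
proof -
  let ?D = "R - T"
  have tD: "transpose ?D = ?D"
    using R(1) T(1) by (simp add: transpose_def vec_eq_iff)
  then obtain Q d where Q: "orthogonal_matrix Q" and D: "?D = Q ** diagonal_matrix d ** transpose Q"
    by (rule symmetric_matrix_spectral)
  have "d i = 0" for i
  proof (rule ccontr)
    assume nz: "d i \<noteq> 0"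
    let ?v = "Q *v axis i 1"
    have QQ: "transpose Q *v ?v = axis i 1"
      using Q by (simp add: matrix_vector_mul_assoc orthogonal_matrix_def)
    have "?D *v ?v = Q *v (diagonal_matrix d *v axis i 1)"
      unfolding D by (simp only: QQ matrix_vector_mul_assoc[symmetric])
    also have "diagonal_matrix d *v axis i 1 = d i *\<^sub>R axis i 1"
      by (auto simp: diagonal_matrix_vector_mult axis_def vec_eq_iff)
    finally have Dv: "?D *v ?v = d i *\<^sub>R ?v"
      by (simp add: matrix_vector_mult_scaleR)
    have "R *v (?D *v ?v) + ?D *v (T *v ?v) = R ** R *v ?v - T ** T *v ?v"
      by (simp add: matrix_vector_mult_diff_rdistrib matrix_vector_mult_diff_distrib flip: matrix_vector_mul_assoc)
    then have "0 = ?v \<bullet> (R *v (?D *v ?v)) + ?v \<bullet> (?D *v (T *v ?v))"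
      using eq by (simp flip: inner_add_right)
    also have "\<dots> = d i * (?v \<bullet> (R *v ?v) + ?v \<bullet> (T *v ?v))"
      using symmetric_matrix_inner[OF tD, of ?v] Dv
      by (simp add: matrix_vector_mult_scaleR algebra_simps)
    finally have "?v \<bullet> (R *v ?v) + ?v \<bullet> (T *v ?v) = 0"
      using nz by simp
    then have "?v \<bullet> (R *v ?v) = 0" "?v \<bullet> (T *v ?v) = 0"
      using R(2)[of ?v] T(2)[of ?v] by linarith+
    then have "?v \<bullet> (?D *v ?v) = 0"
      by (simp add: matrix_vector_mult_diff_rdistrib inner_diff_right)
    then have "?v = 0"
      using Dv nz by simp
    then have "axis i 1 = (0 :: real ^ 'n)"
      using QQ by simp
    then show False
      by (simp add: axis_eq_0_iff)
  qed
  then have "diagonal_matrix d = 0"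
    by (simp add: diagonal_matrix_def vec_eq_iff)
  then have "?D = 0"
    using D by simp
  then show ?thesis by simp
qed

text \<open>The spectral theorem provides the root \<open>R\<close> of \<open>transpose F ** F\<close> and shows that its
  characteristic polynomial splits, so that both choices in the definition of the singular values are
  made among existing objects. Evaluating the characteristic polynomial at 0 gives the product,
  with \<open>det R\<close> equal to \<open>det F\<close> because both are nonnegative with the same square.\<close>

lemma singular_values_pos_and_prod:
  fixes F :: "real ^ 'n ^ 'n"
  assumes F: "F \<in> GL_plus"
  shows "0 < singular_values F $ i" and "(\<Prod>i\<in>UNIV. singular_values F $ i) = det F"
proof -
  let ?A = "transpose F ** F"
  have "transpose ?A = ?A"
    by (simp add: matrix_transpose_mul)
  then obtain Q d where Q: "orthogonal_matrix Q" and A: "?A = Q ** diagonal_matrix d ** transpose Q"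
    by (rule symmetric_matrix_spectral)
  have QQ: "transpose Q ** Q = mat 1"
    using Q by (simp add: orthogonal_matrix_def)
  have d: "0 \<le> d i" for i
  proof -
    let ?v = "Q *v axis i 1"
    have "0 \<le> (F *v ?v) \<bullet> (F *v ?v)" by simp
    also have "\<dots> = ?v \<bullet> (?A *v ?v)"
      using inner_matrix_vector_mult[of ?v "transpose F" "F *v ?v"]
      by (simp only: matrix_vector_mul_assoc transpose_transpose matrix_mul_assoc)
    also have "\<dots> = (\<Sum>j\<in>UNIV. d j * (axis i 1 $ j)\<^sup>2)"
      unfolding A inner_orthogonal_conjugate by (simp add: matrix_vector_mul_assoc QQ)
    also have "\<dots> = (\<Sum>j\<in>UNIV. if j = i then d j else 0)"
      by (intro sum.cong refl) (simp add: axis_def)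
    also have "\<dots> = d i"
      by simp
    finally show ?thesis .
  qed
  define R where "R = Q ** diagonal_matrix (\<lambda>i. sqrt (d i)) ** transpose Q"
  have tR: "transpose R = R"
    unfolding R_def by (rule transpose_orthogonal_conjugate)
  have psd: "0 \<le> v \<bullet> (R *v v)" for v
    unfolding R_def inner_orthogonal_conjugate by (intro sum_nonneg) (simp add: d)
  have RR: "R ** R = ?A"
  proof -
    have "R ** R = Q ** (diagonal_matrix (\<lambda>i. sqrt (d i)) ** (transpose Q ** Q) **
        diagonal_matrix (\<lambda>i. sqrt (d i))) ** transpose Q"
      by (simp add: R_def matrix_mul_assoc)
    then show ?thesis
      using d by (simp add: QQ diagonal_matrix_mult A)
  qed
  have "psd_sqrt ?A = R"
    unfolding psd_sqrt_def
  proof (rule the_equality)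
    show "transpose R = R \<and> (\<forall>v. 0 \<le> v \<bullet> (R *v v)) \<and> R ** R = ?A"
      using tR psd RR by blast
    fix T assume T: "transpose T = T \<and> (\<forall>v. 0 \<le> v \<bullet> (T *v v)) \<and> T ** T = ?A"
    then have "T ** T = R ** R"
      by (simp only: RR)
    with T show "T = R"
      using psd_square_root_unique[of T R] tR psd by blast
  qed
  moreover have det_R: "det (mat t - R) = (\<Prod>i\<in>UNIV. t - sqrt (d i))" for t
    unfolding R_def by (rule det_orthogonal_conjugate[OF Q])
  then have "lists_eigenvalues R (\<chi> i. sqrt (d i))"
    by (simp add: lists_eigenvalues_def)
  ultimately have sv: "lists_eigenvalues R (singular_values F)"
    unfolding singular_values_def by (metis someI)
  have prod: "(\<Prod>i\<in>UNIV. s $ i) = det R" if "lists_eigenvalues R s" for s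
  proof -
    have "(\<Prod>i\<in>UNIV. 0 - s $ i) = det (mat 0 - R)"
      using that unfolding lists_eigenvalues_def by metis
    moreover have "mat 0 - R = (- 1) *\<^sub>R R"
      by (simp add: mat_def vec_eq_iff)
    moreover have "det ((- 1) *\<^sub>R R) = (- 1) ^ CARD('n) * det R"
      by (simp add: det_def prod_uminus sum_distrib_left algebra_simps)
    moreover have "(\<Prod>i\<in>UNIV. 0 - s $ i) = (- 1) ^ CARD('n) * (\<Prod>i\<in>UNIV. s $ i)"
      by (simp add: prod_uminus)
    ultimately show ?thesis by simp
  qed
  have "0 \<le> det R"
    using prod[OF \<open>lists_eigenvalues R (\<chi> i. sqrt (d i))\<close>] d prod_nonneg[of UNIV "\<lambda>i. sqrt (d i)"] by simp
  moreover have "(det R)\<^sup>2 = (det F)\<^sup>2"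
    by (metis RR det_mul det_transpose power2_eq_square)
  ultimately have "det R = det F"
    using F by (simp add: GL_plus_def power2_eq_iff)
  then show pr: "(\<Prod>i\<in>UNIV. singular_values F $ i) = det F"
    using prod[OF sv] by simp
  show "0 < singular_values F $ i"
  proof -
    let ?s = "singular_values F $ i"
    have "det (mat ?s - R) = 0"
      using sv by (auto simp: lists_eigenvalues_def)
    then have "0 = (\<Prod>i\<in>UNIV. ?s - sqrt (d i))"
      using det_R by simp
    then obtain j where "?s = sqrt (d j)"
      by (auto simp: eq_commute[of 0])
    then have "0 \<le> ?s"
      using d by simp
    moreover have "?s \<noteq> 0"
    proof
      assume "?s = 0"
      then have "(\<Prod>i\<in>UNIV. singular_values F $ i) = 0"
        by (intro prod_zero) auto
      then show False
        using pr F by (simp add: GL_plus_def)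
    qed
    ultimately show ?thesis by simp
  qed
qed


section \<open>Integrals of determinants depending polynomially on a parameter\<close>

lemma det_add_scaleR_expansion:
  fixes A B :: "real ^ 'n ^ 'n"
  shows "det (A + t *\<^sub>R B) = (\<Sum>\<pi>\<in>{\<pi>. \<pi> permutes UNIV}. \<Sum>X\<in>Pow UNIV.
           t ^ card X * (of_int (sign \<pi>) * (\<Prod>i\<in>X. B $ i $ \<pi> i) * (\<Prod>i\<in>UNIV - X. A $ i $ \<pi> i)))"
  unfolding det_def
proof (intro sum.cong refl)
  fix \<pi> :: "'n \<Rightarrow> 'n"
  have "(\<Prod>i\<in>UNIV. (A + t *\<^sub>R B) $ i $ \<pi> i) = (\<Prod>i\<in>UNIV. t * B $ i $ \<pi> i + A $ i $ \<pi> i)"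
    by (simp add: add.commute)
  also have "\<dots> = (\<Sum>X\<in>Pow UNIV. (\<Prod>i\<in>X. t * B $ i $ \<pi> i) * (\<Prod>i\<in>UNIV - X. A $ i $ \<pi> i))"
    by (rule prod_add) simp
  finally show "of_int (sign \<pi>) * (\<Prod>i\<in>UNIV. (A + t *\<^sub>R B) $ i $ \<pi> i) =
      (\<Sum>X\<in>Pow UNIV. t ^ card X * (of_int (sign \<pi>) * (\<Prod>i\<in>X. B $ i $ \<pi> i) * (\<Prod>i\<in>UNIV - X. A $ i $ \<pi> i)))"
    by (simp add: sum_distrib_left prod.distrib mult_ac)
qed

lemma integral_det_pencil_polynomial:
  fixes A B :: "'a \<Rightarrow> real ^ 'n ^ 'n"
  assumes "finite_measure M"
    and meas: "\<And>i j. (\<lambda>x. A x $ i $ j) \<in> borel_measurable M" "\<And>i j. (\<lambda>x. B x $ i $ j) \<in> borel_measurable M"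
    and bound: "\<And>x i j. x \<in> space M \<Longrightarrow> \<bar>A x $ i $ j\<bar> \<le> C" "\<And>x i j. x \<in> space M \<Longrightarrow> \<bar>B x $ i $ j\<bar> \<le> C"
  obtains q where "\<And>t. integrable M (\<lambda>x. det (A x + t *\<^sub>R B x))"
    and "\<And>t. (\<integral>x. det (A x + t *\<^sub>R B x) \<partial>M) = poly q t"
proof -
  interpret finite_measure M by fact
  define c where "c \<pi> X x = of_int (sign \<pi>) * (\<Prod>i\<in>X. B x $ i $ \<pi> i) * (\<Prod>i\<in>UNIV - X. A x $ i $ \<pi> i)"
    for \<pi> :: "'n \<Rightarrow> 'n" and X x
  have c: "integrable M (c \<pi> X)" for \<pi> X
  proof (rule integrable_const_bound)
    show "c \<pi> X \<in> borel_measurable M"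
      unfolding c_def by (intro borel_measurable_times borel_measurable_prod borel_measurable_const meas)
    show "AE x in M. norm (c \<pi> X x) \<le> (\<Prod>i\<in>X. C) * (\<Prod>i\<in>UNIV - X. C)"
    proof (rule AE_I2)
      fix x assume x: "x \<in> space M"
      have "norm (c \<pi> X x) = (\<Prod>i\<in>X. \<bar>B x $ i $ \<pi> i\<bar>) * (\<Prod>i\<in>UNIV - X. \<bar>A x $ i $ \<pi> i\<bar>)"
        by (simp add: c_def abs_mult abs_prod sign_def)
      also have "\<dots> \<le> (\<Prod>i\<in>X. C) * (\<Prod>i\<in>UNIV - X. C)"
        using bound x by (intro mult_mono prod_mono prod_nonneg) (auto intro: order_trans[OF abs_ge_zero])
      finally show "norm (c \<pi> X x) \<le> (\<Prod>i\<in>X. C) * (\<Prod>i\<in>UNIV - X. C)" .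
    qed
  qed
  have det: "det (A x + t *\<^sub>R B x) = (\<Sum>\<pi>\<in>{\<pi>. \<pi> permutes UNIV}. \<Sum>X\<in>Pow UNIV. t ^ card X * c \<pi> X x)" for x t
    unfolding det_add_scaleR_expansion c_def ..
  show thesis
  proof
    show "integrable M (\<lambda>x. det (A x + t *\<^sub>R B x))" for t
      unfolding det by (intro Bochner_Integration.integrable_sum integrable_mult_right c)
    show "(\<integral>x. det (A x + t *\<^sub>R B x) \<partial>M) =
        poly (\<Sum>\<pi>\<in>{\<pi>. \<pi> permutes UNIV}. \<Sum>X\<in>Pow UNIV. monom (\<integral>x. c \<pi> X x \<partial>M) (card X)) t" for t
      unfolding det poly_sum poly_monom
      by (simp add: Bochner_Integration.integral_sum c mult.commute)
  qed
qed

text \<open>A polynomial that is constant on an interval is constant. This transports an identity known for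
  small perturbations to the perturbation of size 1.\<close>

lemma integral_det_pencil_const:
  fixes A B :: "'a \<Rightarrow> real ^ 'n ^ 'n"
  assumes "finite_measure M"
    and meas: "\<And>i j. (\<lambda>x. A x $ i $ j) \<in> borel_measurable M" "\<And>i j. (\<lambda>x. B x $ i $ j) \<in> borel_measurable M"
    and bound: "\<And>x i j. x \<in> space M \<Longrightarrow> \<bar>A x $ i $ j\<bar> \<le> C" "\<And>x i j. x \<in> space M \<Longrightarrow> \<bar>B x $ i $ j\<bar> \<le> C"
    and const: "0 < \<delta>" "\<And>t. 0 < t \<Longrightarrow> t < \<delta> \<Longrightarrow> (\<integral>x. det (A x + t *\<^sub>R B x) \<partial>M) = m"
  shows "(\<integral>x. det (A x + t *\<^sub>R B x) \<partial>M) = m"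
proof -
  obtain q where q: "\<And>t. (\<integral>x. det (A x + t *\<^sub>R B x) \<partial>M) = poly q t"
    using integral_det_pencil_polynomial[OF assms(1) meas bound] by metis
  have "{0<..<\<delta>} \<subseteq> {t. poly (q - [:m:]) t = 0}"
    using const(2) q by auto
  then have "q - [:m:] = 0"
    using poly_roots_finite[of "q - [:m:]"] const(1) infinite_Ioo finite_subset by blast
  then show ?thesis
    using q by simp
qed

section \<open>Small Lipschitz perturbations of the identity\<close>

lemma lipschitz_has_derivative_norm_le:
  fixes f :: "'a::real_normed_vector \<Rightarrow> 'b::real_normed_vector"
  assumes der: "(f has_derivative D) (at x)" and "open U" "x \<in> U" and lip: "L-lipschitz_on U f"
  shows "norm (D v) \<le> L * norm v"
proof (rule field_le_epsilon)
  fix e :: real assume "0 < e"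
  define e' where "e' = e / (norm v + 1)"
  have e': "0 < e'" using \<open>0 < e\<close> by (simp add: e'_def add_nonneg_pos)
  interpret D: bounded_linear D using der by (rule has_derivative_bounded_linear)
  obtain d where d: "0 < d" and le: "\<And>y. norm (y - x) < d \<Longrightarrow> norm (f y - f x - D (y - x)) \<le> e' * norm (y - x)"
    using der e' unfolding has_derivative_at_alt by blast
  obtain r where r: "0 < r" "ball x r \<subseteq> U"
    using \<open>open U\<close> \<open>x \<in> U\<close> open_contains_ball by blast
  define s where "s = min d r / (2 * (norm v + 1))"
  have s: "0 < s" using d r by (simp add: s_def add_nonneg_pos)
  have "s * norm v \<le> s * (norm v + 1)" using s by simp
  also have "\<dots> = min d r / 2"
    by (simp add: s_def field_simps add_nonneg_eq_0_iff)
  finally have sv: "s * norm v < d" "s * norm v < r"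
    using d r by linarith+
  let ?y = "x + s *\<^sub>R v"
  have "norm (f ?y - f x - D (s *\<^sub>R v)) \<le> e' * (s * norm v)"
    using le[of ?y] s sv by simp
  moreover have "norm (f ?y - f x) \<le> L * (s * norm v)"
    using lipschitz_onD[OF lip, of ?y x] r \<open>x \<in> U\<close> s sv by (auto simp: dist_norm subset_iff)
  ultimately have "norm (D (s *\<^sub>R v)) \<le> L * (s * norm v) + e' * (s * norm v)"
    using norm_triangle_ineq4[of "f ?y - f x" "f ?y - f x - D (s *\<^sub>R v)"] by simp
  then have "s * norm (D v) \<le> s * ((L + e') * norm v)"
    using s by (simp add: D.scaleR algebra_simps)
  then have "norm (D v) \<le> L * norm v + e' * norm v"
    using s by (simp only: mult_le_cancel_left_pos distrib_right)
  also have "e' * norm v \<le> e"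
  proof -
    have "norm v < norm v + 1" "0 < norm v + 1" by (simp_all add: add_nonneg_pos)
    then show ?thesis using \<open>0 < e\<close> by (simp add: e'_def pos_divide_le_eq)
  qed
  finally show "norm (D v) \<le> L * norm v + e" by simp
qed

text \<open>Along the segment from \<open>mat 1\<close> all matrices are invertible, since a kernel vector \<open>v\<close> would
  satisfy \<open>norm v = s * norm (B *v v) < norm v\<close>. So the determinant keeps the sign it has at the
  identity.\<close>

lemma det_perturbed_identity_pos:
  fixes B :: "real ^ 'n ^ 'n"
  assumes bound: "\<And>v. norm (B *v v) \<le> K * norm v" and t: "0 \<le> t" "t * K < 1"
  shows "0 < det (mat 1 + t *\<^sub>R B)"
proof (rule ccontr)
  assume "\<not> 0 < det (mat 1 + t *\<^sub>R B)"
  moreover have "continuous_on {0..t} (\<lambda>s. det (mat 1 + s *\<^sub>R B))"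
    unfolding det_def by (intro continuous_intros)
  ultimately obtain s where s: "0 \<le> s" "s \<le> t" "det (mat 1 + s *\<^sub>R B) = 0"
    using IVT2'[of "\<lambda>s. det (mat 1 + s *\<^sub>R B)" t 0 0] t(1) by auto
  then obtain v where v: "v \<noteq> 0" "(mat 1 + s *\<^sub>R B) *v v = 0"
    by (metis invertible_det_nz invertible_left_inverse matrix_left_invertible_ker)
  then have "v = - (s *\<^sub>R (B *v v))"
    by (simp add: matrix_vector_mult_add_rdistrib scaleR_matrix_vector_assoc[symmetric] eq_neg_iff_add_eq_0)
  then have "norm v = s * norm (B *v v)"
    using s(1) by (metis abs_of_nonneg norm_minus_cancel norm_scaleR)
  also have "\<dots> \<le> s * (K * norm v)"
    using bound s(1) by (simp add: mult_left_mono)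
  finally have 1: "1 \<le> s * K"
    using v(1) by (simp add: mult.assoc[symmetric])
  then have "0 \<le> K"
    using s(1) by (smt (verit) mult_nonneg_nonpos)
  then show False
    using 1 s(2) t(2) mult_right_mono by fastforce
qed

text \<open>A segment from a point of \<open>\<Omega>\<close> to a point outside meets the frontier, where \<open>u\<close> vanishes.
  Hence the extension keeps the Lipschitz constant.\<close>

lemma lipschitz_extend_by_zero:
  fixes u :: "'a::euclidean_space \<Rightarrow> 'b::real_normed_vector"
  assumes lip: "K-lipschitz_on (closure \<Omega>) u" and zero: "\<And>x. x \<in> frontier \<Omega> \<Longrightarrow> u x = 0"
  shows "K-lipschitz_on UNIV (\<lambda>x. if x \<in> \<Omega> then u x else 0)" (is "_-lipschitz_on _ ?u")
proof (rule lipschitz_onI)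
  have mixed: "dist (?u x) (?u y) \<le> K * dist x y" if "x \<in> \<Omega>" "y \<notin> \<Omega>" for x y
  proof -
    have "x \<in> closed_segment x y" "y \<in> closed_segment x y"
      by simp_all
    then have "closed_segment x y \<inter> frontier \<Omega> \<noteq> {}"
      using that by (intro connected_Int_frontier connected_segment) blast+
    then obtain z where z: "z \<in> closed_segment x y" "z \<in> frontier \<Omega>"
      by blast
    have "dist (?u x) (?u y) = dist (u x) (u z)"
      using that zero[OF z(2)] by simp
    also have "\<dots> \<le> K * dist x z"
      using lipschitz_onD[OF lip] that(1) z(2) closure_subset by (auto simp: frontier_def subset_iff)
    also have "\<dots> \<le> K * dist x y"
      using z(1) dist_in_closed_segment[of z x y] lipschitz_on_nonneg[OF lip]
      by (simp add: mult_left_mono dist_commute)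
    finally show ?thesis .
  qed
  fix x y
  show "dist (?u x) (?u y) \<le> K * dist x y"
    using mixed[of x y] mixed[of y x] lipschitz_onD[OF lip, of x y] lipschitz_on_nonneg[OF lip] closure_subset[of \<Omega>]
    by (cases "x \<in> \<Omega>"; cases "y \<in> \<Omega>") (auto simp: dist_commute)
next
  show "0 \<le> K" using lip by (rule lipschitz_on_nonneg)
qed

text \<open>Solving \<open>x + t *\<^sub>R u x = y\<close> means finding the fixed point of the contraction
  \<open>x \<mapsto> y - t *\<^sub>R u x\<close>, so the map is a bijection of the whole space. It is the identity outside
  \<open>\<Omega>\<close>, therefore it permutes the points of \<open>\<Omega>\<close> among themselves.\<close>

lemma small_perturbation_bij_betw:
  fixes u :: "'a::banach \<Rightarrow> 'a"
  assumes lip: "K-lipschitz_on UNIV u" and zero: "\<And>x. x \<notin> \<Omega> \<Longrightarrow> u x = 0"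
    and t: "0 \<le> t" "t * K < 1"
  shows "bij_betw (\<lambda>x. x + t *\<^sub>R u x) \<Omega> \<Omega>"
proof -
  let ?g = "\<lambda>x. x + t *\<^sub>R u x"
  have contr: "dist (y - t *\<^sub>R u x) (y - t *\<^sub>R u x') \<le> t * K * dist x x'" for x x' y
    using lipschitz_onD[OF lip, of x x'] t(1)
    by (simp add: dist_norm norm_minus_commute mult.assoc mult_left_mono flip: scaleR_diff_right)
  have K: "0 \<le> t * K"
    using t(1) lipschitz_on_nonneg[OF lip] by simp
  have fix1: "\<exists>!x. y - t *\<^sub>R u x = x" for y
    by (rule banach_fix_type[OF K t(2)]) (use contr in auto)
  have bij: "\<exists>!x. ?g x = y" for y
  proof -
    have "?g x = y \<longleftrightarrow> y - t *\<^sub>R u x = x" for x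
      by (auto simp: algebra_simps)
    then show ?thesis using fix1[of y] by simp
  qed
  then have inj: "?g x = ?g y \<Longrightarrow> x = y" for x y
    by metis
  have "?g x \<in> \<Omega>" if "x \<in> \<Omega>" for x
  proof (rule ccontr)
    assume *: "?g x \<notin> \<Omega>"
    then have "?g (?g x) = ?g x" by (simp add: zero)
    then show False using inj * that by metis
  qed
  moreover have "y \<in> ?g ` \<Omega>" if "y \<in> \<Omega>" for y
  proof -
    obtain x where x: "?g x = y" using bij by metis
    with zero[of x] that show ?thesis by (cases "x \<in> \<Omega>") auto
  qed
  moreover have "inj_on ?g \<Omega>"
    by (rule inj_onI) (rule inj)
  ultimately show ?thesis
    by (auto simp: bij_betw_def)
qed


section \<open>The integral of the Jacobian determinant\<close>

text \<open>The change of variables theorem is about index types with a well-order; the result is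
  carried over to arbitrary finite index types below. On the null set of points where \<open>\<phi>\<close> is not
  differentiable \<open>jacobian\<close> has no meaning; replacing it by \<open>mat 1\<close> there makes the integrand on \<open>\<Omega>\<close>
  equal to \<open>det (mat 1 + B x)\<close> with a bounded measurable \<open>B\<close>.\<close>

lemma integral_det_jacobian_wellorder:
  fixes \<phi> :: "real ^ 'm::{finite,wellorder} \<Rightarrow> real ^ 'm::_"
  assumes "bounded \<Omega>" "open \<Omega>" and lip: "L-lipschitz_on (closure \<Omega>) \<phi>"
    and diff: "AE x in lebesgue_on \<Omega>. \<phi> differentiable (at x)"
    and bd: "\<And>x. x \<in> frontier \<Omega> \<Longrightarrow> \<phi> x = x"
  defines "d \<equiv> \<lambda>x. det (if \<phi> differentiable (at x) then jacobian \<phi> (at x) else mat 1)"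
  shows "integrable (lebesgue_on \<Omega>) d \<and> (\<integral>x. d x \<partial>lebesgue_on \<Omega>) = measure lebesgue \<Omega>"
proof -
  define S where "S = {x \<in> \<Omega>. \<phi> differentiable (at x)}"
  define K where "K = L + 1"
  define B where "B x = (if x \<in> S then jacobian \<phi> (at x) - mat 1 else 0)" for x
  define u where "u x = (if x \<in> \<Omega> then \<phi> x - x else 0)" for x
  have \<Omega>: "\<Omega> \<in> lmeasurable" "\<Omega> \<in> sets lebesgue"
    using assms(1,2) by (auto intro: lmeasurable_open)
  have neg: "negligible (\<Omega> - S)"
  proof -
    have "AE x in lebesgue. x \<in> \<Omega> \<longrightarrow> \<phi> differentiable (at x)"
      using diff \<Omega>(2) by (simp add: AE_restrict_space_iff)
    then have "{x \<in> space lebesgue. \<not> (x \<in> \<Omega> \<longrightarrow> \<phi> differentiable (at x))} \<in> null_sets lebesgue"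
      by (simp only: completion.AE_iff_null_sets)
    moreover have "{x \<in> space lebesgue. \<not> (x \<in> \<Omega> \<longrightarrow> \<phi> differentiable (at x))} = \<Omega> - S"
      by (auto simp: S_def)
    ultimately show ?thesis
      by (simp add: negligible_iff_null_sets)
  qed
  then have S: "S \<in> sets lebesgue"
    by (intro sets_negligible_symdiff[OF \<Omega>(2)] negligible_subset[OF neg]) (auto simp: S_def)
  have "K-lipschitz_on (closure \<Omega>) (\<lambda>x. \<phi> x - x)"
    unfolding K_def using lip lipschitz_on_id by (rule lipschitz_on_diff)
  then have lip_u: "K-lipschitz_on UNIV u"
    unfolding u_def[abs_def] by (rule lipschitz_extend_by_zero) (simp add: bd)
  have K: "0 \<le> K" using lip_u by (rule lipschitz_on_nonneg)
  have der_\<phi>: "(\<phi> has_derivative (*v) (jacobian \<phi> (at x))) (at x)" if "x \<in> S" for x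
    using that by (simp add: S_def jacobian_works)
  have der_u: "(u has_derivative (*v) (B x)) (at x)" if "x \<in> S" for x
  proof -
    have "((\<lambda>x. \<phi> x - x) has_derivative (\<lambda>v. jacobian \<phi> (at x) *v v - v)) (at x)"
      by (intro derivative_intros der_\<phi> that)
    moreover have "(\<lambda>v. jacobian \<phi> (at x) *v v - v) = (*v) (B x)"
      using that by (simp add: B_def matrix_vector_mult_diff_rdistrib fun_eq_iff)
    ultimately show ?thesis
      using that \<open>open \<Omega>\<close>
      by (auto simp: u_def S_def elim!: has_derivative_transform_within_open)
  qed
  have norm_B: "norm (B x *v v) \<le> K * norm v" for x v
  proof (cases "x \<in> S")
    case True
    show ?thesis
      by (rule lipschitz_has_derivative_norm_le[OF der_u[OF True] open_UNIV UNIV_I lip_u])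
  qed (simp add: B_def K)
  have B_entry: "\<bar>B x $ i $ j\<bar> \<le> K" for x i j
  proof -
    have "\<bar>B x $ i $ j\<bar> = \<bar>(B x *v axis j 1) $ i\<bar>"
      by (simp add: matrix_vector_mult_basis column_def)
    also have "\<dots> \<le> norm (B x *v axis j 1)"
      by (rule component_le_norm_cart)
    also have "\<dots> \<le> K"
      using norm_B[of x "axis j 1"] by (simp add: norm_axis_1)
    finally show ?thesis .
  qed
  have meas_B: "(\<lambda>x. B x $ i $ j) \<in> borel_measurable (lebesgue_on \<Omega>)" for i j
  proof -
    have "(\<lambda>x. matrix ((*v) (B x)) $ i $ j) \<in> borel_measurable (lebesgue_on S)"
      by (rule borel_measurable_partial_derivatives[OF S, of u]) (rule has_derivative_at_withinI[OF der_u])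
    then have "(\<lambda>x. B x $ i $ j) \<in> borel_measurable (lebesgue_on S)"
      by (simp add: matrix_of_matrix_vector_mul)
    then have "(\<lambda>x. if x \<in> S then B x $ i $ j else 0) \<in> borel_measurable (lebesgue_on \<Omega>)"
      using S \<Omega>(2) by (subst borel_measurable_if_lebesgue_on) (auto simp: S_def)
    moreover have "(\<lambda>x. if x \<in> S then B x $ i $ j else 0) = (\<lambda>x. B x $ i $ j)"
      by (auto simp: B_def)
    ultimately show ?thesis by simp
  qed
  have fin: "finite_measure (lebesgue_on \<Omega>)"
    using \<Omega>(1) by (rule finite_measure_lebesgue_on)
  have one: "\<bar>mat 1 $ i $ j :: real\<bar> \<le> K + 1" for i j :: 'm
    using K by (simp add: mat_def)
  have B1: "\<bar>B x $ i $ j\<bar> \<le> K + 1" for x i j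
    using B_entry[of x i j] by simp
  obtain q where int: "\<And>t. integrable (lebesgue_on \<Omega>) (\<lambda>x. det (mat 1 + t *\<^sub>R B x))"
    using integral_det_pencil_polynomial[OF fin borel_measurable_const meas_B one B1] by blast
  have small: "(\<integral>x. det (mat 1 + t *\<^sub>R B x) \<partial>lebesgue_on \<Omega>) = measure lebesgue \<Omega>"
    if t: "0 < t" "t < 1 / (K + 1)" for t
  proof -
    have tK: "t * K < 1"
      using t K by (simp add: less_divide_eq algebra_simps)
    let ?g = "\<lambda>x. x + t *\<^sub>R u x"
    have bij: "bij_betw ?g \<Omega> \<Omega>"
      using lip_u t(1) tK by (intro small_perturbation_bij_betw) (auto simp: u_def)
    have der_g: "(?g has_derivative (*v) (mat 1 + t *\<^sub>R B x)) (at x within S)" if "x \<in> S" for x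
    proof -
      have "(?g has_derivative (\<lambda>v. v + t *\<^sub>R (B x *v v))) (at x within S)"
        using der_u[OF that] by (intro derivative_intros) (auto intro: has_derivative_at_withinI)
      moreover have "(\<lambda>v. v + t *\<^sub>R (B x *v v)) = (*v) (mat 1 + t *\<^sub>R B x)"
        by (simp add: matrix_vector_mult_add_rdistrib scaleR_matrix_vector_assoc fun_eq_iff)
      ultimately show ?thesis by simp
    qed
    \<comment> \<open>Change of variables applies on \<open>S\<close> only; the rest of \<open>\<Omega>\<close> has a null image.\<close>
    have neg_img: "negligible (?g ` (\<Omega> - S))"
    proof (rule negligible_locally_Lipschitz_image[OF order_refl neg])
      fix x
      have "norm (?g y - ?g x) \<le> (1 + t * K) * norm (y - x)" for y
      proof -
        have "norm (?g y - ?g x) \<le> norm (y - x) + norm (t *\<^sub>R (u y - u x))"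
          using norm_triangle_ineq[of "y - x" "t *\<^sub>R (u y - u x)"] by (simp add: algebra_simps)
        also have "norm (t *\<^sub>R (u y - u x)) \<le> t * (K * norm (y - x))"
          using lipschitz_onD[OF lip_u, of y x] t(1) by (simp add: dist_norm)
        finally show ?thesis by (simp add: algebra_simps)
      qed
      then show "\<exists>T B. open T \<and> x \<in> T \<and> (\<forall>y\<in>(\<Omega> - S) \<inter> T. norm (?g y - ?g x) \<le> B * norm (y - x))"
        by (intro exI[of _ UNIV] exI[of _ "1 + t * K"]) auto
    qed
    have img: "?g ` S = \<Omega> - ?g ` (\<Omega> - S)"
    proof -
      have "?g ` S = ?g ` (\<Omega> - (\<Omega> - S))"
        by (rule arg_cong[of _ _ "(`) ?g"]) (auto simp: S_def)
      also have "\<dots> = ?g ` \<Omega> - ?g ` (\<Omega> - S)"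
        using bij by (intro inj_on_image_set_diff[of ?g \<Omega>]) (auto simp: bij_betw_def)
      finally show ?thesis using bij by (simp add: bij_betw_def)
    qed
    have sym_diff: "negligible (\<Omega> - ?g ` S \<union> (?g ` S - \<Omega>))"
      using neg_img by (rule negligible_subset) (auto simp: img)
    have inj: "inj_on ?g S"
      using bij by (auto simp: bij_betw_def S_def intro: inj_on_subset)
    have "?g ` S \<in> lmeasurable \<and> measure lebesgue (?g ` S) = measure lebesgue \<Omega>"
      using \<Omega>(1) sym_diff lmeasurable_negligible_symdiff measure_negligible_symdiff by blast
    then have "((\<lambda>x. \<bar>det (matrix ((*v) (mat 1 + t *\<^sub>R B x)))\<bar>) has_integral measure lebesgue \<Omega>) S"
      using has_measure_differentiable_image[OF S, of ?g "\<lambda>x. (*v) (mat 1 + t *\<^sub>R B x)"] der_g inj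
      by blast
    then have "((\<lambda>x. det (mat 1 + t *\<^sub>R B x)) has_integral measure lebesgue \<Omega>) S"
      using det_perturbed_identity_pos[OF norm_B less_imp_le[OF t(1)] tK]
      by (simp add: matrix_of_matrix_vector_mul abs_of_pos)
    then have "((\<lambda>x. det (mat 1 + t *\<^sub>R B x)) has_integral measure lebesgue \<Omega>) \<Omega>"
      by (rule has_integral_spike_set_eq[THEN iffD1, rotated 2])
         (auto intro: negligible_subset[OF neg] simp: S_def)
    then show ?thesis
      using has_integral_integral_lebesgue_on[OF int \<Omega>(2)] has_integral_unique by blast
  qed
  have total: "(\<integral>x. det (mat 1 + 1 *\<^sub>R B x) \<partial>lebesgue_on \<Omega>) = measure lebesgue \<Omega>"
    by (rule integral_det_pencil_const[OF fin borel_measurable_const meas_B one B1 _ small])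
       (use K in auto)
  have "mat 1 + 1 *\<^sub>R B x = (if \<phi> differentiable (at x) then jacobian \<phi> (at x) else mat 1)"
    if "x \<in> \<Omega>" for x
    using that by (simp add: B_def S_def)
  then have "d x = det (mat 1 + 1 *\<^sub>R B x)" if "x \<in> \<Omega>" for x
    using that by (simp add: d_def)
  then have d: "d x = det (mat 1 + 1 *\<^sub>R B x)" if "x \<in> space (lebesgue_on \<Omega>)" for x
    using that by (simp add: space_restrict_space)
  have "integrable (lebesgue_on \<Omega>) d = integrable (lebesgue_on \<Omega>) (\<lambda>x. det (mat 1 + 1 *\<^sub>R B x))"
    by (rule Bochner_Integration.integrable_cong[OF refl d])
  moreover have "(\<integral>x. d x \<partial>lebesgue_on \<Omega>) = (\<integral>x. det (mat 1 + 1 *\<^sub>R B x) \<partial>lebesgue_on \<Omega>)"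
    by (rule Bochner_Integration.integral_cong[OF refl d])
  ultimately show ?thesis
    using int[of 1] total by (simp only: simp_thms)
qed


section \<open>Independence of the order of the coordinates\<close>

text \<open>A copy of a finite index type that carries a well-order, namely the one induced by an
  enumeration. A vector indexed by \<open>'n\<close> is turned into one indexed by the copy by renaming its
  coordinates, which is an isometry and preserves Lebesgue measure and determinants.\<close>

typedef 'a ordered_index = "UNIV :: 'a set"
  morphisms the_index Index ..

lemma bij_the_index: "bij the_index"
  by (metis Index_inverse UNIV_I bijI' the_index_inject)

instance ordered_index :: (finite) finite
proof
  have "inj (the_index :: 'a ordered_index \<Rightarrow> 'a)"
    using bij_the_index by (rule bij_is_inj)
  then show "finite (UNIV :: 'a ordered_index set)"
    by (rule finite_imageD[rotated]) simp
qed

instantiation ordered_index :: (finite) wellorder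
begin

definition less_eq_ordered_index :: "'a ordered_index \<Rightarrow> 'a ordered_index \<Rightarrow> bool" where
  "x \<le> y \<longleftrightarrow> to_nat (the_index x) \<le> to_nat (the_index y)"

definition less_ordered_index :: "'a ordered_index \<Rightarrow> 'a ordered_index \<Rightarrow> bool" where
  "x < y \<longleftrightarrow> to_nat (the_index x) < to_nat (the_index y)"

instance
proof
  fix P :: "'a ordered_index \<Rightarrow> bool" and x
  assume step: "\<And>x. (\<And>y. y < x \<Longrightarrow> P y) \<Longrightarrow> P x"
  show "P x"
    by (induction x rule: measure_induct_rule[of "\<lambda>x. to_nat (the_index x)"])
      (rule step, simp add: less_ordered_index_def)
qed (auto simp: less_eq_ordered_index_def less_ordered_index_def the_index_inject)

end

definition reindex :: "('m \<Rightarrow> 'n) \<Rightarrow> 'a ^ 'n \<Rightarrow> 'a ^ 'm" where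
  "reindex \<sigma> x = (\<chi> i. x $ \<sigma> i)"

lemma reindex_nth [simp]: "reindex \<sigma> x $ i = x $ \<sigma> i"
  by (simp add: reindex_def)

lemma reindex_inv [simp]:
  assumes "bij \<sigma>"
  shows "reindex (inv \<sigma>) (reindex \<sigma> x) = x" "reindex \<sigma> (reindex (inv \<sigma>) y) = y"
  using assms by (simp_all add: vec_eq_iff bij_is_surj surj_f_inv_f bij_is_inj)

lemma linear_reindex: "linear (reindex \<sigma> :: real ^ 'n \<Rightarrow> real ^ 'm)"
  by (rule linearI) (simp_all add: vec_eq_iff)

lemma norm_reindex:
  fixes x :: "real ^ 'n" and \<sigma> :: "'m::finite \<Rightarrow> 'n"
  assumes "bij \<sigma>"
  shows "norm (reindex \<sigma> x) = norm x"
  unfolding norm_eq_sqrt_inner inner_vec_def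
  using sum.reindex_bij_betw[OF assms, of "\<lambda>i. x $ i \<bullet> x $ i"] by simp

lemma det_reindex:
  fixes A :: "real ^ 'n ^ 'n" and \<sigma> :: "'m::finite \<Rightarrow> 'n"
  assumes "bij \<sigma>"
  shows "det (\<chi> i j. A $ \<sigma> i $ \<sigma> j) = det A"
proof -
  let ?\<tau> = "inv \<sigma>"
  have \<tau>: "bij ?\<tau>" using assms by (rule bij_imp_bij_inv)
  have "(\<Sum>\<pi>\<in>{\<pi>. \<pi> permutes UNIV}. of_int (sign \<pi>) * (\<Prod>i\<in>UNIV. A $ i $ \<pi> i))
      = (\<Sum>\<pi>\<in>{\<pi>. \<pi> permutes UNIV}. of_int (sign \<pi>) * (\<Prod>i\<in>UNIV. A $ \<sigma> i $ \<sigma> (\<pi> i)))"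
  proof (rule sum.reindex_bij_witness[of _ "map_permutation UNIV \<sigma>" "map_permutation UNIV ?\<tau>"])
    fix \<pi> :: "'n \<Rightarrow> 'n" assume "\<pi> \<in> {\<pi>. \<pi> permutes UNIV}"
    then have \<pi>: "\<pi> permutes UNIV" by simp
    have app: "map_permutation UNIV ?\<tau> \<pi> i = ?\<tau> (\<pi> (\<sigma> i))" for i
      using map_permutation_apply[of ?\<tau> UNIV "\<sigma> i" \<pi>] \<tau> assms by (simp add: bij_is_inj)
    show "map_permutation UNIV ?\<tau> \<pi> \<in> {\<pi>. \<pi> permutes UNIV}"
      using map_permutation_permutes[OF \<tau> \<pi>] by simp
    show "map_permutation UNIV \<sigma> (map_permutation UNIV ?\<tau> \<pi>) = \<pi>"
      by (rule map_permutation_compose_inv[OF \<tau> \<pi>]) (simp add: assms bij_is_surj surj_f_inv_f)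
    have "(\<Prod>i\<in>UNIV. A $ i $ \<pi> i) = (\<Prod>i\<in>UNIV. A $ \<sigma> i $ \<pi> (\<sigma> i))"
      using prod.reindex_bij_betw[OF assms, of "\<lambda>i. A $ i $ \<pi> i"] by simp
    then show "of_int (sign (map_permutation UNIV ?\<tau> \<pi>)) * (\<Prod>i\<in>UNIV. A $ \<sigma> i $ \<sigma> (map_permutation UNIV ?\<tau> \<pi> i))
        = of_int (sign \<pi>) * (\<Prod>i\<in>UNIV. A $ i $ \<pi> i)"
      using sign_map_permutation[OF bij_is_inj[OF \<tau>] \<pi>] assms
      by (simp add: app bij_is_surj surj_f_inv_f)
  next
    fix \<pi> :: "'m \<Rightarrow> 'm" assume "\<pi> \<in> {\<pi>. \<pi> permutes UNIV}"
    then have \<pi>: "\<pi> permutes UNIV" by simp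
    show "map_permutation UNIV \<sigma> \<pi> \<in> {\<pi>. \<pi> permutes UNIV}"
      using map_permutation_permutes[OF assms \<pi>] by simp
    show "map_permutation UNIV ?\<tau> (map_permutation UNIV \<sigma> \<pi>) = \<pi>"
      by (rule map_permutation_compose_inv[OF assms \<pi>]) (simp add: assms bij_is_inj)
  qed
  then show ?thesis
    unfolding det_def by simp
qed

lemma prod_Basis_cart: "(\<Prod>b\<in>Basis. (x :: real ^ 'n) \<bullet> b) = (\<Prod>i\<in>UNIV. x $ i)"
proof -
  have "(Basis :: (real ^ 'n) set) = (\<lambda>i. axis i 1) ` (UNIV :: 'n set)"
    by (auto simp: Basis_vec_def)
  moreover have inj: "inj (\<lambda>i. axis i (1 :: real) :: real ^ 'n)"
    by (auto simp: inj_def axis_eq_axis)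
  ultimately show ?thesis
    using prod.reindex[OF inj, of "(\<bullet>) x"] by (simp add: inner_axis)
qed

lemma continuous_reindex: "continuous_on S (reindex \<sigma> :: real ^ 'n \<Rightarrow> real ^ 'm)"
  by (rule linear_continuous_on) (simp add: linear_conv_bounded_linear[symmetric] linear_reindex)

text \<open>Lebesgue measure is determined by the volumes of boxes, and the preimage of a box is the box with
  renamed sides.\<close>

lemma distr_reindex_lborel:
  fixes \<sigma> :: "'m::finite \<Rightarrow> 'n::finite"
  assumes "bij \<sigma>"
  shows "distr lborel lborel (reindex \<sigma>) = (lborel :: (real ^ 'm) measure)"
proof (rule lborel_eqI[symmetric])
  have meas: "(reindex \<sigma> :: real ^ 'n \<Rightarrow> real ^ 'm) \<in> borel_measurable borel"
    by (rule borel_measurable_continuous_onI) (rule continuous_reindex)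
  fix l u :: "real ^ 'm"
  assume le: "\<And>b. b \<in> Basis \<Longrightarrow> l \<bullet> b \<le> u \<bullet> b"
  let ?l = "reindex (inv \<sigma>) l" and ?u = "reindex (inv \<sigma>) u"
  have le': "l $ i \<le> u $ i" for i
    using le[of "axis i 1"] by (simp add: inner_axis axis_in_Basis_iff)
  have "emeasure (distr lborel lborel (reindex \<sigma>)) (box l u) = emeasure lborel (reindex \<sigma> -` box l u)"
    using meas by (subst emeasure_distr) auto
  also have "reindex \<sigma> -` box l u = box ?l ?u"
  proof (rule set_eqI)
    fix x
    have "(\<forall>i. l $ i < x $ \<sigma> i \<and> x $ \<sigma> i < u $ i) \<longleftrightarrow>
        (\<forall>j. l $ inv \<sigma> j < x $ j \<and> x $ j < u $ inv \<sigma> j)"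
      using assms by (metis bij_inv_eq_iff)
    then show "x \<in> reindex \<sigma> -` box l u \<longleftrightarrow> x \<in> box ?l ?u"
      by (simp add: mem_box_cart)
  qed
  also have "emeasure lborel (box ?l ?u) = ennreal (\<Prod>b\<in>Basis. (?u - ?l) \<bullet> b)"
    by (rule emeasure_lborel_box) (auto simp: Basis_vec_def inner_axis le')
  also have "(\<Prod>b\<in>Basis. (?u - ?l) \<bullet> b) = (\<Prod>j\<in>UNIV. (u - l) $ inv \<sigma> j)"
    unfolding prod_Basis_cart by simp
  also have "\<dots> = (\<Prod>i\<in>UNIV. (u - l) $ i)"
    by (rule prod.reindex_bij_betw) (rule bij_imp_bij_inv[OF assms])
  finally show "emeasure (distr lborel lborel (reindex \<sigma>)) (box l u) = ennreal (\<Prod>b\<in>Basis. (u - l) \<bullet> b)"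
    by (simp add: prod_Basis_cart)
qed simp

lemma distr_reindex_lebesgue:
  fixes \<sigma> :: "'m::finite \<Rightarrow> 'n::finite"
  assumes "bij \<sigma>"
  shows "distr lebesgue lebesgue (reindex \<sigma>) = (lebesgue :: (real ^ 'm) measure)"
    and "reindex \<sigma> \<in> lebesgue \<rightarrow>\<^sub>M (lebesgue :: (real ^ 'm) measure)"
proof -
  have meas: "(reindex \<sigma> :: real ^ 'n \<Rightarrow> real ^ 'm) \<in> lborel \<rightarrow>\<^sub>M lborel"
    using borel_measurable_continuous_onI[OF continuous_reindex, of \<sigma>] by simp
  then have meas': "(reindex \<sigma> :: real ^ 'n \<Rightarrow> real ^ 'm) \<in> lebesgue \<rightarrow>\<^sub>M lborel"
    by (rule measurable_completion)
  have eq: "distr lebesgue lborel (reindex \<sigma>) = (lborel :: (real ^ 'm) measure)"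
    using distr_completion[OF meas] distr_reindex_lborel[OF assms] by simp
  then have null: "null_sets (distr lebesgue lborel (reindex \<sigma>)) = null_sets (lborel :: (real ^ 'm) measure)"
    by simp
  then show "distr lebesgue lebesgue (reindex \<sigma>) = (lebesgue :: (real ^ 'm) measure)"
    using completion.completion_distr_eq[OF meas' null] eq by simp
  show "reindex \<sigma> \<in> lebesgue \<rightarrow>\<^sub>M (lebesgue :: (real ^ 'm) measure)"
    using completion.measurable_completion2[OF meas'] null by simp
qed

lemma has_derivative_reindex:
  fixes \<phi> :: "real ^ 'n \<Rightarrow> real ^ 'n" and \<sigma> :: "'m::finite \<Rightarrow> 'n"
  assumes "bij \<sigma>" and der: "(\<phi> has_derivative D) (at x)"
  shows "((\<lambda>y. reindex \<sigma> (\<phi> (reindex (inv \<sigma>) y))) has_derivative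
           (\<lambda>v. reindex \<sigma> (D (reindex (inv \<sigma>) v)))) (at (reindex \<sigma> x))"
proof -
  have "(\<phi> has_derivative D) (at (reindex (inv \<sigma>) (reindex \<sigma> x)))"
    using der assms(1) by simp
  moreover have "(reindex (inv \<sigma>) has_derivative reindex (inv \<sigma>)) (at (reindex \<sigma> x))"
    by (rule linear_imp_has_derivative[OF linear_reindex])
  ultimately have "(\<phi> \<circ> reindex (inv \<sigma>) has_derivative D \<circ> reindex (inv \<sigma>)) (at (reindex \<sigma> x))"
    by (rule diff_chain_at[rotated])
  from diff_chain_at[OF this linear_imp_has_derivative[OF linear_reindex[of \<sigma>]]]
  show ?thesis by (simp add: comp_def)
qed

lemma jacobian_reindex:
  fixes \<phi> :: "real ^ 'n \<Rightarrow> real ^ 'n" and \<sigma> :: "'m::finite \<Rightarrow> 'n"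
  assumes \<sigma>: "bij \<sigma>" and diff: "\<phi> differentiable (at x)"
  shows "jacobian (\<lambda>y. reindex \<sigma> (\<phi> (reindex (inv \<sigma>) y))) (at (reindex \<sigma> x))
       = (\<chi> i j. jacobian \<phi> (at x) $ \<sigma> i $ \<sigma> j)"
proof -
  have "(\<phi> has_derivative (*v) (jacobian \<phi> (at x))) (at x)"
    using diff by (simp add: jacobian_works)
  from frechet_derivative_at[OF has_derivative_reindex[OF \<sigma> this]]
  have "jacobian (\<lambda>y. reindex \<sigma> (\<phi> (reindex (inv \<sigma>) y))) (at (reindex \<sigma> x))
      = matrix (\<lambda>v. reindex \<sigma> (jacobian \<phi> (at x) *v reindex (inv \<sigma>) v))"
    by (simp add: jacobian_def)
  moreover have "reindex (inv \<sigma>) (axis j 1) = (axis (\<sigma> j) 1 :: real ^ 'n)" for j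
    using \<sigma> by (simp add: vec_eq_iff axis_def) (metis bij_inv_eq_iff)
  ultimately show ?thesis
    by (simp add: matrix_def vec_eq_iff matrix_vector_mult_basis column_def)
qed

lemma differentiable_reindex_iff:
  fixes \<phi> :: "real ^ 'n \<Rightarrow> real ^ 'n" and \<sigma> :: "'m::finite \<Rightarrow> 'n"
  assumes \<sigma>: "bij \<sigma>"
  shows "(\<lambda>y. reindex \<sigma> (\<phi> (reindex (inv \<sigma>) y))) differentiable (at (reindex \<sigma> x)) \<longleftrightarrow> \<phi> differentiable (at x)"
proof
  assume "\<phi> differentiable (at x)"
  then show "(\<lambda>y. reindex \<sigma> (\<phi> (reindex (inv \<sigma>) y))) differentiable (at (reindex \<sigma> x))"
    using has_derivative_reindex[OF \<sigma>] by (auto simp: differentiable_def)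
next
  assume "(\<lambda>y. reindex \<sigma> (\<phi> (reindex (inv \<sigma>) y))) differentiable (at (reindex \<sigma> x))"
  then obtain D where "((\<lambda>y. reindex \<sigma> (\<phi> (reindex (inv \<sigma>) y))) has_derivative D) (at (reindex \<sigma> x))"
    by (auto simp: differentiable_def)
  from has_derivative_reindex[OF bij_imp_bij_inv[OF \<sigma>] this]
  show "\<phi> differentiable (at x)"
    using \<sigma> by (auto simp: differentiable_def inv_inv_eq)
qed

text \<open>The mean of the Jacobian determinant depends only on the boundary values. The conjugate
  \<open>?\<psi>\<close> of \<open>\<phi>\<close> by the renaming of the coordinates satisfies the same assumptions and has the same
  Jacobian determinants.\<close>

theorem integral_det_jacobian:
  fixes \<phi> :: "real ^ 'n \<Rightarrow> real ^ 'n"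
  assumes \<Omega>: "bounded \<Omega>" "open \<Omega>" and lip: "L-lipschitz_on (closure \<Omega>) \<phi>"
    and diff: "AE x in lebesgue_on \<Omega>. \<phi> differentiable (at x)"
    and bd: "\<And>x. x \<in> frontier \<Omega> \<Longrightarrow> \<phi> x = x"
  defines "d \<equiv> \<lambda>x. det (if \<phi> differentiable (at x) then jacobian \<phi> (at x) else mat 1)"
  shows "integrable (lebesgue_on \<Omega>) d \<and> (\<integral>x. d x \<partial>lebesgue_on \<Omega>) = measure lebesgue \<Omega>"
proof -
  let ?\<sigma> = "the_index :: 'n ordered_index \<Rightarrow> 'n"
  let ?T = "reindex ?\<sigma> :: real ^ 'n \<Rightarrow> real ^ 'n ordered_index"
  let ?T' = "reindex (inv ?\<sigma>) :: real ^ 'n ordered_index \<Rightarrow> real ^ 'n"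
  have \<sigma>: "bij ?\<sigma>" by (rule bij_the_index)
  have T: "?T' (?T x) = x" "?T (?T' y) = y" for x y
    using \<sigma> by simp_all
  have dist_T: "dist (?T x) (?T y) = dist x y" "dist (?T' x') (?T' y') = dist x' y'" for x y x' y'
    using norm_reindex[OF \<sigma>, of "x - y"] norm_reindex[OF bij_imp_bij_inv[OF \<sigma>], of "x' - y'"]
    by (simp_all add: dist_norm linear_diff[OF linear_reindex])
  have inj_T: "inj ?T"
    by (rule inj_on_inverseI) (rule T(1))
  let ?\<Omega> = "?T ` \<Omega>"
  have vimage: "?T ` X = ?T' -` X" for X
    by (rule set_eqI) (metis T image_iff vimage_eq)
  have \<Omega>': "open ?\<Omega>"
    unfolding vimage by (rule open_vimage[OF \<Omega>(2)]) (rule continuous_reindex)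
  have closure': "closure ?\<Omega> = ?T ` closure \<Omega>"
    by (rule closure_injective_linear_image[symmetric, OF linear_reindex inj_T])
  have frontier': "frontier ?\<Omega> = ?T ` frontier \<Omega>"
    using inj_T \<Omega>(2) \<Omega>' by (simp add: frontier_def closure' interior_open image_set_diff)
  have bounded': "bounded ?\<Omega>"
    using \<Omega>(1) by (rule bounded_linear_image) (simp add: linear_conv_bounded_linear[symmetric] linear_reindex)
  have \<Omega>_leb: "\<Omega> \<inter> space lebesgue \<in> sets lebesgue" "?\<Omega> \<inter> space lebesgue \<in> sets lebesgue"
    using \<Omega>(2) \<Omega>' by auto
  let ?\<psi> = "\<lambda>y. ?T (\<phi> (?T' y))"
  let ?d = "\<lambda>y. det (if ?\<psi> differentiable (at y) then jacobian ?\<psi> (at y) else mat 1)"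
  have diff_iff: "?\<psi> differentiable (at (?T x)) \<longleftrightarrow> \<phi> differentiable (at x)" for x
    by (rule differentiable_reindex_iff[OF \<sigma>])
  have d: "?d (?T x) = d x" for x
    using jacobian_reindex[OF \<sigma>, of \<phi> x] det_reindex[OF \<sigma>, of "jacobian \<phi> (at x)"]
    by (simp add: d_def diff_iff)
  have lip': "L-lipschitz_on (closure ?\<Omega>) ?\<psi>"
    using lip unfolding closure' lipschitz_on_def by (auto simp: dist_T T)
  have ae: "AE y in lebesgue_on ?\<Omega>. ?\<psi> differentiable (at y)"
  proof -
    have "AE x in lebesgue. x \<in> \<Omega> \<longrightarrow> \<phi> differentiable (at x)"
      using diff \<Omega>_leb by (simp add: AE_restrict_space_iff)
    then have neg: "negligible {x \<in> \<Omega>. \<not> \<phi> differentiable (at x)}"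
      by (simp add: completion.AE_iff_null_sets negligible_iff_null_sets)
    have "negligible (?T ` {x \<in> \<Omega>. \<not> \<phi> differentiable (at x)})"
    proof (rule negligible_locally_Lipschitz_image[OF _ neg])
      show "DIM(real ^ 'n) \<le> DIM(real ^ 'n ordered_index)"
        using bij_betw_same_card[OF \<sigma>] by simp
      show "\<exists>U B. open U \<and> x \<in> U \<and> (\<forall>y\<in>{x \<in> \<Omega>. \<not> \<phi> differentiable (at x)} \<inter> U. norm (?T y - ?T x) \<le> B * norm (y - x))" for x
        using dist_T(1) by (intro exI[of _ UNIV] exI[of _ 1]) (simp add: dist_norm)
    qed
    also have "?T ` {x \<in> \<Omega>. \<not> \<phi> differentiable (at x)} = {y. \<not> (y \<in> ?\<Omega> \<longrightarrow> ?\<psi> differentiable (at y))}"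
      using diff_iff by auto
    finally show ?thesis
      using \<Omega>_leb by (simp add: AE_restrict_space_iff completion.AE_iff_null_sets negligible_iff_null_sets)
  qed
  have bd': "?\<psi> y = y" if "y \<in> frontier ?\<Omega>" for y
    using that bd by (auto simp: frontier' T)
  have wo: "integrable (lebesgue_on ?\<Omega>) ?d" "(\<integral>y. ?d y \<partial>lebesgue_on ?\<Omega>) = measure lebesgue ?\<Omega>"
    using integral_det_jacobian_wellorder[OF bounded' \<Omega>' lip' ae bd'] by auto
  have ind: "indicator ?\<Omega> (?T x) *\<^sub>R ?d (?T x) = indicator \<Omega> x *\<^sub>R d x" for x
    unfolding d using inj_T by (simp add: indicator_def inj_image_mem_iff)
  have int: "integrable lebesgue (\<lambda>y. indicator ?\<Omega> y *\<^sub>R ?d y)"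
    using wo(1) \<Omega>_leb by (simp only: integrable_restrict_space)
  then have "integrable (distr lebesgue lebesgue ?T) (\<lambda>y. indicator ?\<Omega> y *\<^sub>R ?d y)"
    unfolding distr_reindex_lebesgue(1)[OF \<sigma>] .
  from integrable_distr[OF distr_reindex_lebesgue(2)[OF \<sigma>] this]
  have "integrable lebesgue (\<lambda>x. indicator \<Omega> x *\<^sub>R d x)"
    unfolding ind .
  then have 1: "integrable (lebesgue_on \<Omega>) d"
    using \<Omega>_leb by (simp only: integrable_restrict_space)
  have "measure lebesgue ?\<Omega> = (\<integral>y. indicator ?\<Omega> y *\<^sub>R ?d y \<partial>distr lebesgue lebesgue ?T)"
    unfolding distr_reindex_lebesgue(1)[OF \<sigma>] using wo(2) \<Omega>_leb by (simp only: integral_restrict_space)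
  also have "\<dots> = (\<integral>x. indicator \<Omega> x *\<^sub>R d x \<partial>lebesgue)"
    unfolding ind[symmetric]
    by (rule integral_distr[OF distr_reindex_lebesgue(2)[OF \<sigma>]]) (rule borel_measurable_integrable[OF int])
  also have "\<dots> = (\<integral>x. d x \<partial>lebesgue_on \<Omega>)"
    using \<Omega>_leb by (simp only: integral_restrict_space)
  finally have 2: "measure lebesgue ?\<Omega> = (\<integral>x. d x \<partial>lebesgue_on \<Omega>)" .
  have "measure lebesgue ?\<Omega> = measure (distr lebesgue lebesgue ?T) ?\<Omega>"
    unfolding distr_reindex_lebesgue(1)[OF \<sigma>] ..
  also have "\<dots> = measure lebesgue (?T -` ?\<Omega> \<inter> space lebesgue)"
    using \<Omega>_leb by (intro measure_distr distr_reindex_lebesgue(2)[OF \<sigma>]) simp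
  finally show ?thesis
    using 1 2 by (simp add: inj_vimage_image_eq[OF inj_T])
qed


section \<open>Energies nonincreasing in the partial sums\<close>

lemma obtain_decreasing_enumeration:
  fixes x :: "real ^ 'n"
  obtains f where "bij_betw f {..<CARD('n)} UNIV"
    and "\<And>i j. i \<le> j \<Longrightarrow> j < CARD('n) \<Longrightarrow> x $ f j \<le> x $ f i"
proof -
  obtain L :: "'n list" where L: "set L = UNIV" "distinct L"
    using finite_distinct_list[of "UNIV :: 'n set"] by auto
  define M where "M = sort_key (\<lambda>i. - x $ i) L"
  have M: "set M = UNIV" "distinct M" "length M = CARD('n)"
    using L distinct_card[OF L(2)] by (simp_all add: M_def)
  have sorted: "sorted (map (\<lambda>i. - x $ i) M)"
    by (simp add: M_def)
  show thesis
  proof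
    show "bij_betw ((!) M) {..<CARD('n)} UNIV"
      by (rule bij_betw_nth) (use M in auto)
    show "x $ (M ! j) \<le> x $ (M ! i)" if "i \<le> j" "j < CARD('n)" for i j
      using sorted_nth_mono[OF sorted that(1)] that M(3) by simp
  qed
qed

lemma nth_partial_sums:
  fixes x :: "real ^ 'n"
  assumes bij: "bij_betw f {..<CARD('n)} UNIV"
    and dec: "\<And>i j. i \<le> j \<Longrightarrow> j < CARD('n) \<Longrightarrow> x $ f j \<le> x $ f i"
    and k: "k < CARD('n)"
  shows "partial_sums x ! k = (\<Sum>i\<le>k. x $ f i)"
proof -
  let ?l = "map (\<lambda>k. x $ f k) [0..<CARD('n)]"
  have "mset_set UNIV = image_mset f (mset_set {..<CARD('n)})"
    using bij by (metis bij_betw_def image_mset_mset_set)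
  then have mset: "image_mset (($) x) (mset_set UNIV) = mset (rev ?l)"
    by (simp add: image_mset.compositionality comp_def lessThan_atLeast0)
  have "sorted (rev ?l)"
    unfolding sorted_rev_iff_nth_mono using dec by simp
  then have "decreasing_rearrangement x = ?l"
    unfolding decreasing_rearrangement_def mset sorted_list_of_multiset_mset
    by (simp only: sorted_sort_id rev_rev_ident)
  then have "partial_sums x ! k = sum_list (take (Suc k) ?l)"
    using k by (simp add: partial_sums_def)
  also have "\<dots> = sum_list (map (\<lambda>k. x $ f k) [0..<Suc k])"
    using k by (simp add: take_map del: upt_Suc)
  also have "\<dots> = (\<Sum>i\<le>k. x $ f i)"
    by (simp add: interv_sum_list_conv_sum_set_nat lessThan_atLeast0[symmetric] lessThan_Suc_atMost del: upt_Suc)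
  finally show ?thesis .
qed

lemma sum_along_enumeration:
  fixes x :: "real ^ 'n"
  assumes "bij_betw f {..<CARD('n)} (UNIV :: 'n set)"
  shows "(\<Sum>i\<in>UNIV. x $ i) = (\<Sum>i<CARD('n). x $ f i)"
  using sum.reindex_bij_betw[OF assms, of "($) x"] by simp

text \<open>The average of the first terms of a decreasing sequence is at least the average of all terms.
  If \<open>a k\<close> is at least \<open>c\<close>, then so are all terms before; otherwise all terms after \<open>a k\<close> are
  less than \<open>c\<close>, and the first ones must compensate.\<close>

lemma decreasing_prefix_sum_ge:
  fixes a :: "nat \<Rightarrow> real"
  assumes dec: "\<And>i j. i \<le> j \<Longrightarrow> j < N \<Longrightarrow> a j \<le> a i" and k: "k < N"
    and c: "real N * c \<le> (\<Sum>i<N. a i)"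
  shows "real (Suc k) * c \<le> (\<Sum>i\<le>k. a i)"
proof (cases "c \<le> a k")
  case True
  have "(\<Sum>i\<le>k. c) \<le> (\<Sum>i\<le>k. a i)"
    using dec[of _ k] k True by (intro sum_mono) force
  then show ?thesis by simp
next
  case False
  have "(\<Sum>i\<in>{Suc k..<N}. a i) \<le> (\<Sum>i\<in>{Suc k..<N}. c)"
    by (rule sum_mono) (use dec[of k] False in \<open>simp, smt (verit) Suc_leD\<close>)
  also have "\<dots> = real N * c - real (Suc k) * c"
    using k by (simp add: of_nat_diff algebra_simps)
  moreover have "(\<Sum>i<N. a i) = (\<Sum>i\<le>k. a i) + (\<Sum>i\<in>{Suc k..<N}. a i)"
    using k sum.atLeastLessThan_concat[of 0 "Suc k" N a]
    by (simp add: lessThan_atLeast0[symmetric] lessThan_Suc_atMost del: sum.lessThan_Suc)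
  ultimately show ?thesis using c by linarith
qed

text \<open>The energy as a function of the logarithmic stretches, the logarithms of the singular values.\<close>

locale log_stretch_energy =
  fixes h :: "real ^ 'n \<Rightarrow> real" and p :: "real list \<Rightarrow> real"
  assumes p: "\<And>x. p (partial_sums x) = h x"
    and h_convex: "convex_on UNIV h"
    and p_noninc: "nonincreasing_in_each_argument (range (partial_sums :: real ^ 'n \<Rightarrow> real list)) p"
    and h_sym: "\<And>\<pi> x. \<pi> permutes UNIV \<Longrightarrow> h (\<chi> i. x $ \<pi> i) = h x"
begin

lemma single_partial_sum_mono:
  assumes bij: "bij_betw f {..<CARD('n)} (UNIV :: 'n set)"
    and decx: "\<And>i j. i \<le> j \<Longrightarrow> j < CARD('n) \<Longrightarrow> x $ f j \<le> x $ f i"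
    and decy: "\<And>i j. i \<le> j \<Longrightarrow> j < CARD('n) \<Longrightarrow> y $ f j \<le> y $ f i"
    and k: "k < CARD('n)" and le: "(\<Sum>i\<le>k. y $ f i) \<le> (\<Sum>i\<le>k. x $ f i)"
    and eq: "\<And>j. j < CARD('n) \<Longrightarrow> j \<noteq> k \<Longrightarrow> (\<Sum>i\<le>j. y $ f i) = (\<Sum>i\<le>j. x $ f i)"
  shows "h x \<le> h y"
proof -
  have len: "length (partial_sums z) = CARD('n)" for z :: "real ^ 'n"
    by (simp add: partial_sums_def)
  have "p (partial_sums x) \<le> p (partial_sums y)"
    using p_noninc[unfolded nonincreasing_in_each_argument_def, rule_format,
        of "partial_sums y" "partial_sums x" k] k le eq
    by (simp add: len nth_partial_sums[OF bij decx] nth_partial_sums[OF bij decy])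
  then show ?thesis by (simp add: p)
qed

text \<open>Monotonicity in each argument only compares vectors of partial sums that belong to
  the range of \<open>partial_sums\<close>, so lowering the partial sums of \<open>x\<close> one after the other is possible
  only if the intermediate vectors are still arranged in decreasing order. If the coordinates of \<open>x\<close>
  are distinct, this holds for all sufficiently small moves.\<close>

lemma local_partial_sums_mono:
  assumes bij: "bij_betw f {..<CARD('n)} (UNIV :: 'n set)"
    and strict: "\<And>i j. i < j \<Longrightarrow> j < CARD('n) \<Longrightarrow> x $ f j < x $ f i"
    and D: "\<And>k. k < CARD('n) \<Longrightarrow> (\<Sum>i\<le>k. d $ f i) \<le> 0"
  shows "\<exists>t. 0 < t \<and> t \<le> 1 \<and> h x \<le> h (x + t *\<^sub>R d)"
proof -
  let ?N = "CARD('n)"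
  \<comment> \<open>\<open>E j k\<close> is the change, up to the factor \<open>t\<close>, of the partial sum number \<open>k\<close> after the first \<open>j\<close> of
    them were changed, and \<open>e j i\<close> is the corresponding change of the coordinate number \<open>i\<close>.\<close>
  define E where "E j k = (if k < j then \<Sum>i\<le>k. d $ f i else 0)" for j k :: nat
  define e where "e j i = E j i - (if i = 0 then 0 else E j (i - 1))" for j i
  have sum_e: "(\<Sum>i\<le>k. e j i) = E j k" for j k
    by (induction k) (simp_all add: e_def)
  have e_N: "e ?N i = d $ f i" if "i < ?N" for i
    using that by (cases i) (simp_all add: e_def E_def)
  define C where "C = Max ((\<lambda>(j, i). \<bar>e j i\<bar>) ` ({..?N} \<times> {..<?N}))"
  have C: "\<bar>e j i\<bar> \<le> C" if "j \<le> ?N" "i < ?N" for j i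
    unfolding C_def using that by (intro Max_ge) auto
  have "0 \<le> C"
    using C[of 0 0] by (meson abs_ge_zero order_trans le0 zero_less_card_finite)
  define \<gamma> where "\<gamma> = Min (insert 1 ((\<lambda>(i, j). x $ f i - x $ f j) ` {(i, j). i < j \<and> j < ?N}))"
  have fin: "finite {(i, j). i < j \<and> j < ?N}"
    by (rule finite_subset[of _ "{..<?N} \<times> {..<?N}"]) auto
  have \<gamma>: "0 < \<gamma>"
    unfolding \<gamma>_def using fin strict by (subst Min_gr_iff) auto
  have gap: "\<gamma> \<le> x $ f i - x $ f j" if "i < j" "j < ?N" for i j
    unfolding \<gamma>_def using fin that by (intro Min_le) auto
  \<comment> \<open>Two neighbouring coordinates approach each other by at most \<open>t * (2 * C)\<close>, which must not exceed
    their distance; the summand 1 excludes division by 0.\<close>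
  define t where "t = min 1 (\<gamma> / (2 * C + 1))"
  have t: "0 < t" "t \<le> 1"
    using \<gamma> \<open>0 \<le> C\<close> by (simp_all add: t_def)
  have "t * (2 * C) \<le> t * (2 * C + 1)" using t by simp
  also have "\<dots> \<le> \<gamma> / (2 * C + 1) * (2 * C + 1)"
    using \<open>0 \<le> C\<close> by (intro mult_right_mono) (auto simp: t_def)
  also have "\<dots> = \<gamma>" using \<open>0 \<le> C\<close> by simp
  finally have tC: "t * (2 * C) \<le> \<gamma>" .
  define y where "y j = (\<chi> a. x $ a + t * e j (inv_into {..<?N} f a))" for j
  have y: "y j $ f i = x $ f i + t * e j i" if "i < ?N" for i j
    using that bij by (simp add: y_def bij_betw_inv_into_left)
  have dec: "y j $ f i' \<le> y j $ f i" if "i \<le> i'" "i' < ?N" "j \<le> ?N" for i i' j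
  proof (cases "i = i'")
    case False
    have "t * (e j i' - e j i) \<le> t * (2 * C)"
      using C[OF that(3), of i] C[OF that(3), of i'] that t(1) by (intro mult_left_mono) auto
    also have "\<dots> \<le> x $ f i - x $ f i'"
      using tC gap[of i i'] False that by simp
    finally show ?thesis
      using that by (simp add: y algebra_simps)
  qed simp
  have sums: "(\<Sum>i\<le>k. y j $ f i) = (\<Sum>i\<le>k. x $ f i) + t * E j k" if "k < ?N" for j k
  proof -
    have "(\<Sum>i\<le>k. y j $ f i) = (\<Sum>i\<le>k. x $ f i + t * e j i)"
      using that by (intro sum.cong refl y) simp
    then show ?thesis
      by (simp add: sum.distrib sum_e flip: sum_distrib_left)
  qed
  have "h x \<le> h (y j)" if "j \<le> ?N" for j
    using that
  proof (induction j)
    case 0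
    have "e 0 i = 0" for i
      by (cases i) (simp_all add: e_def E_def)
    then have "y 0 = x"
      by (simp add: y_def)
    then show ?case by simp
  next
    case (Suc j)
    have "h (y j) \<le> h (y (Suc j))"
    proof (rule single_partial_sum_mono[OF bij])
      show "y j $ f i' \<le> y j $ f i" "y (Suc j) $ f i' \<le> y (Suc j) $ f i"
        if "i \<le> i'" "i' < ?N" for i i'
        using dec that Suc.prems by auto
      show "j < ?N" using Suc.prems by simp
      then show "(\<Sum>i\<le>j. y (Suc j) $ f i) \<le> (\<Sum>i\<le>j. y j $ f i)"
        using D[of j] t(1) by (simp add: sums E_def mult_nonneg_nonpos)
      show "(\<Sum>i\<le>k. y (Suc j) $ f i) = (\<Sum>i\<le>k. y j $ f i)" if "k < ?N" "k \<noteq> j" for k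
        using that by (simp add: sums E_def)
    qed
    then show ?case using Suc by simp
  qed
  then have "h x \<le> h (y ?N)" by simp
  also have "y ?N = x + t *\<^sub>R d"
  proof (rule vec_eq_iff[THEN iffD2], rule allI)
    fix a
    obtain i where "i < ?N" "a = f i"
      using bij by (metis bij_betw_imp_surj_on imageE lessThan_iff UNIV_I)
    then show "y ?N $ a = (x + t *\<^sub>R d) $ a"
      by (simp add: y e_N)
  qed
  finally show ?thesis using t by blast
qed

text \<open>Convexity makes the local comparison global: on the segment from \<open>x\<close> to \<open>z\<close> the
  function \<open>h\<close> is at least \<open>h x\<close> at some point other than \<open>x\<close>, hence \<open>h z\<close> cannot be less than \<open>h x\<close>.\<close>

lemma partial_sums_mono:
  assumes bij: "bij_betw f {..<CARD('n)} (UNIV :: 'n set)"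
    and strict: "\<And>i j. i < j \<Longrightarrow> j < CARD('n) \<Longrightarrow> x $ f j < x $ f i"
    and le: "\<And>k. k < CARD('n) \<Longrightarrow> (\<Sum>i\<le>k. z $ f i) \<le> (\<Sum>i\<le>k. x $ f i)"
  shows "h x \<le> h z"
proof -
  obtain t where t: "0 < t" "t \<le> 1" "h x \<le> h (x + t *\<^sub>R (z - x))"
    using local_partial_sums_mono[OF bij strict, of "z - x"] le by (auto simp: sum_subtractf)
  have "x + t *\<^sub>R (z - x) = (1 - t) *\<^sub>R x + t *\<^sub>R z"
    by (simp add: algebra_simps)
  then have "h (x + t *\<^sub>R (z - x)) \<le> (1 - t) * h x + t * h z"
    using convex_onD[OF h_convex, of t x z] t by simp
  then have "t * h x \<le> t * h z"
    using t(3) by (simp add: algebra_simps)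
  then show ?thesis using t(1) by simp
qed

definition profile :: "real \<Rightarrow> real" where
  "profile s = h (\<chi> i. s / CARD('n))"

text \<open>The constant vector with the mean of the coordinates of \<open>x\<close> is the average of all
  rearrangements of \<open>x\<close>.\<close>

lemma profile_sum_le: "profile (\<Sum>i\<in>UNIV. x $ i) \<le> h x"
proof -
  let ?P = "{\<pi> :: 'n \<Rightarrow> 'n. \<pi> permutes UNIV}"
  have fin: "finite ?P" by (rule finite_permutations) simp
  have ne: "?P \<noteq> {}" using permutes_id by blast
  define c where "c = real (card ?P)"
  have c: "0 < c" using fin ne by (simp add: c_def card_gt_0_iff)
  define S where "S i = (\<Sum>\<pi>\<in>?P. x $ \<pi> i)" for i
  have S_eq: "S i = S j" for i j
    unfolding S_def
    by (subst sum_permutations_compose_right[OF permutes_swap_id[of i UNIV j]]) simp_all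
  have "(\<Sum>i\<in>UNIV. S i) = (\<Sum>\<pi>\<in>?P. \<Sum>i\<in>UNIV. x $ \<pi> i)"
    unfolding S_def by (rule sum.swap)
  also have "\<dots> = (\<Sum>\<pi>\<in>?P. \<Sum>i\<in>UNIV. x $ i)"
  proof (rule sum.cong[OF refl])
    fix \<pi> assume "\<pi> \<in> ?P"
    then show "(\<Sum>i\<in>UNIV. x $ \<pi> i) = (\<Sum>i\<in>UNIV. x $ i)"
      using sum.permute[of \<pi> UNIV "($) x"] by (simp add: comp_def)
  qed
  finally have total: "(\<Sum>i\<in>UNIV. S i) = c * (\<Sum>i\<in>UNIV. x $ i)"
    by (simp add: c_def)
  have "(\<Sum>j\<in>UNIV. S j) = real CARD('n) * S i" for i
  proof -
    have "(\<Sum>j\<in>UNIV. S j) = (\<Sum>j\<in>(UNIV :: 'n set). S i)"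
      by (intro sum.cong refl S_eq)
    then show ?thesis by simp
  qed
  then have "real CARD('n) * S i = c * (\<Sum>i\<in>UNIV. x $ i)" for i
    using total by metis
  then have S: "(1 / c) * S i = (\<Sum>i\<in>UNIV. x $ i) / CARD('n)" for i
    using c by (simp add: field_simps)
  have "h (\<Sum>\<pi>\<in>?P. (1 / c) *\<^sub>R (\<chi> i. x $ \<pi> i)) \<le> (\<Sum>\<pi>\<in>?P. (1 / c) * h (\<chi> i. x $ \<pi> i))"
  proof (rule convex_on_sum[OF fin ne h_convex])
    have "(\<Sum>\<pi>\<in>?P. 1 / c) = c * (1 / c)"
      by (simp only: sum_constant c_def)
    also have "\<dots> = 1"
      using c by simp
    finally show "(\<Sum>\<pi>\<in>?P. 1 / c) = 1" .
  qed (use c in auto)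
  also have "\<dots> = h x"
  proof -
    have "(\<Sum>\<pi>\<in>?P. (1 / c) * h (\<chi> i. x $ \<pi> i)) = (\<Sum>\<pi>\<in>?P. (1 / c) * h x)"
      by (intro sum.cong refl) (simp add: h_sym)
    also have "\<dots> = c * ((1 / c) * h x)"
      by (simp only: sum_constant c_def)
    also have "\<dots> = h x"
      using c by simp
    finally show ?thesis .
  qed
  also have "(\<Sum>\<pi>\<in>?P. (1 / c) *\<^sub>R (\<chi> i. x $ \<pi> i)) = (\<chi> i. (\<Sum>i\<in>UNIV. x $ i) / CARD('n))"
    unfolding vec_eq_iff using S by (simp add: S_def sum_divide_distrib)
  finally show ?thesis by (simp add: profile_def)
qed

text \<open>The averages of the first coordinates of \<open>x\<close>, arranged in decreasing order, are at least the mean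
  of all of them, so the constant vector of sum \<open>s\<close> has the smaller partial sums.\<close>

lemma le_profile_distinct:
  assumes inj: "inj (($) x)" and s: "s \<le> (\<Sum>i\<in>UNIV. x $ i)"
  shows "h x \<le> profile s"
proof -
  obtain f where bij: "bij_betw f {..<CARD('n)} (UNIV :: 'n set)"
    and dec: "\<And>i j. i \<le> j \<Longrightarrow> j < CARD('n) \<Longrightarrow> x $ f j \<le> x $ f i"
    using obtain_decreasing_enumeration[of x] by blast
  have strict: "x $ f j < x $ f i" if "i < j" "j < CARD('n)" for i j
  proof -
    have "f i \<noteq> f j"
      using bij that by (auto simp: bij_betw_def inj_on_def)
    then have "x $ f i \<noteq> x $ f j"
      using inj by (simp add: inj_eq)
    then show ?thesis using dec[of i j] that by simp
  qed
  show ?thesis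
    unfolding profile_def
  proof (rule partial_sums_mono[OF bij strict])
    fix k assume "k < CARD('n)"
    then show "(\<Sum>i\<le>k. (\<chi> i. s / CARD('n)) $ f i) \<le> (\<Sum>i\<le>k. x $ f i)"
      using decreasing_prefix_sum_ge[of "CARD('n)" "\<lambda>i. x $ f i" k "s / CARD('n)"] dec s
      by (simp add: sum_along_enumeration[OF bij])
  qed
qed

lemma obtain_distinct_sum_zero:
  obtains v :: "real ^ 'n" where "inj (($) v)" "(\<Sum>i\<in>UNIV. v $ i) = 0"
proof -
  obtain r :: "'n \<Rightarrow> nat" where r: "inj r"
    using finite_imp_inj_to_nat_seg[of "UNIV :: 'n set"] by auto
  let ?m = "(\<Sum>i\<in>UNIV. real (r i)) / CARD('n)"
  show thesis
  proof
    show "inj (($) (\<chi> i. real (r i) - ?m))"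
      using r by (auto simp: inj_def)
    show "(\<Sum>i\<in>UNIV. (\<chi> i. real (r i) - ?m) $ i) = 0"
      by (simp add: sum_subtractf)
  qed
qed

lemma profile_antimono: "antimono profile"
proof (rule antimonoI)
  fix s s' :: real assume "s \<le> s'"
  obtain v :: "real ^ 'n" where v: "inj (($) v)" "(\<Sum>i\<in>UNIV. v $ i) = 0"
    by (rule obtain_distinct_sum_zero)
  let ?x = "\<chi> i. s' / CARD('n) + v $ i"
  have sum: "(\<Sum>i\<in>UNIV. ?x $ i) = s'"
    using v(2) by (simp add: sum.distrib)
  have "inj (($) ?x)"
    using v(1) by (simp add: inj_def)
  then show "profile s' \<le> profile s"
    using le_profile_distinct[of ?x s] profile_sum_le[of ?x] \<open>s \<le> s'\<close> sum by simp
qed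

text \<open>If coordinates of \<open>x\<close> coincide, then \<open>x\<close> is the midpoint of two vectors with distinct
  coordinates and the same sum; convexity carries the upper bound over to \<open>x\<close>.\<close>

lemma h_eq_profile: "h x = profile (\<Sum>i\<in>UNIV. x $ i)"
proof (rule antisym)
  obtain v :: "real ^ 'n" where v: "inj (($) v)" "(\<Sum>i\<in>UNIV. v $ i) = 0"
    by (rule obtain_distinct_sum_zero)
  \<comment> \<open>A finite set that contains all \<open>s\<close> for which \<open>x + s *\<^sub>R v\<close> has coinciding coordinates.\<close>
  let ?B = "(\<lambda>(i, j). (x $ j - x $ i) / (v $ i - v $ j)) ` UNIV"
  have "finite (?B \<union> uminus ` ?B)" by simp
  then obtain \<epsilon> where \<epsilon>: "\<epsilon> \<notin> ?B \<union> uminus ` ?B"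
    using ex_new_if_finite[OF infinite_UNIV_char_0] by blast
  have inj: "inj (($) (x + s *\<^sub>R v))" if "s \<notin> ?B" for s
  proof (rule injI, rule ccontr)
    fix i j assume eq: "(x + s *\<^sub>R v) $ i = (x + s *\<^sub>R v) $ j" and "i \<noteq> j"
    then have "v $ i - v $ j \<noteq> 0"
      using v(1) by (simp add: inj_eq)
    moreover have "s * (v $ i - v $ j) = x $ j - x $ i"
      using eq by (simp add: algebra_simps)
    ultimately have "s = (x $ j - x $ i) / (v $ i - v $ j)"
      by (simp add: eq_divide_eq)
    then show False using that by auto
  qed
  have sum: "(\<Sum>i\<in>UNIV. (x + s *\<^sub>R v) $ i) = (\<Sum>i\<in>UNIV. x $ i)" for s
    using v(2) by (simp add: sum.distrib flip: sum_distrib_left)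
  have bound: "h (x + s *\<^sub>R v) \<le> profile (\<Sum>i\<in>UNIV. x $ i)" if "s \<notin> ?B" for s
    by (rule le_profile_distinct[OF inj[OF that]]) (simp only: sum order_refl)
  have "\<epsilon> \<notin> ?B"
    using \<epsilon> by blast
  moreover have "- \<epsilon> \<notin> ?B"
  proof
    assume "- \<epsilon> \<in> ?B"
    then have "- (- \<epsilon>) \<in> uminus ` ?B" by (rule imageI)
    with \<epsilon> show False by (simp only: minus_minus Un_iff simp_thms)
  qed
  ultimately have le: "h (x + \<epsilon> *\<^sub>R v) \<le> profile (\<Sum>i\<in>UNIV. x $ i)"
      "h (x + (- \<epsilon>) *\<^sub>R v) \<le> profile (\<Sum>i\<in>UNIV. x $ i)"
    by (blast intro: bound)+
  have "x = (1 - 1 / 2) *\<^sub>R (x + \<epsilon> *\<^sub>R v) + (1 / 2) *\<^sub>R (x + (- \<epsilon>) *\<^sub>R v)"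
    by (simp add: vec_eq_iff field_simps)
  then have "h x \<le> (1 - 1 / 2) * h (x + \<epsilon> *\<^sub>R v) + 1 / 2 * h (x + (- \<epsilon>) *\<^sub>R v)"
    using convex_onD[OF h_convex, of "1 / 2" "x + \<epsilon> *\<^sub>R v" "x + (- \<epsilon>) *\<^sub>R v"] by simp
  then show "h x \<le> profile (\<Sum>i\<in>UNIV. x $ i)"
    using le by simp
  show "profile (\<Sum>i\<in>UNIV. x $ i) \<le> h x"
    by (rule profile_sum_le)
qed

lemma profile_convex: "convex_on UNIV profile"
proof (rule convex_onI)
  fix t a b :: real assume t: "0 < t" "t < 1"
  have "(\<chi> i. ((1 - t) *\<^sub>R a + t *\<^sub>R b) / CARD('n)) =
      (1 - t) *\<^sub>R (\<chi> i. a / CARD('n)) + t *\<^sub>R (\<chi> i. b / CARD('n) :: real ^ 'n)"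
    by (simp add: vec_eq_iff add_divide_distrib)
  then show "profile ((1 - t) *\<^sub>R a + t *\<^sub>R b) \<le> (1 - t) * profile a + t * profile b"
    using convex_onD[OF h_convex, of t "\<chi> i. a / CARD('n)" "\<chi> i. b / CARD('n)"] t
    by (simp add: profile_def)
qed simp

end


section \<open>Lower bounds for extended integrals\<close>

lemma extended_integral_ge_integral:
  assumes l: "integrable M l" and f: "f \<in> borel_measurable M" and le: "AE x in M. l x \<le> f x"
  shows "extended_integral_exists M f \<and> ereal (\<integral>x. l x \<partial>M) \<le> extended_integral M f"
proof -
  have pos: "(\<integral>\<^sup>+ x. ennreal (l x) \<partial>M) \<le> (\<integral>\<^sup>+ x. ennreal (f x) \<partial>M)"
    by (rule nn_integral_mono_AE, rule eventually_mono[OF le]) (simp add: ennreal_leI)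
  have neg: "(\<integral>\<^sup>+ x. ennreal (- f x) \<partial>M) \<le> (\<integral>\<^sup>+ x. ennreal (- l x) \<partial>M)"
    by (rule nn_integral_mono_AE, rule eventually_mono[OF le]) (simp add: ennreal_leI)
  have fin: "(\<integral>\<^sup>+ x. ennreal (l x) \<partial>M) < \<infinity>" "(\<integral>\<^sup>+ x. ennreal (- l x) \<partial>M) < \<infinity>"
    using l by (auto simp: real_integrable_def top.not_eq_extremum)
  have to_real: "enn2ereal a = ereal (enn2real a)" if "a < \<infinity>" for a
    using that by (cases a) auto
  have "ereal (\<integral>x. l x \<partial>M) =
      enn2ereal (\<integral>\<^sup>+ x. ennreal (l x) \<partial>M) - enn2ereal (\<integral>\<^sup>+ x. ennreal (- l x) \<partial>M)"
    using fin by (simp add: to_real real_lebesgue_integral_def[OF l])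
  also have "\<dots> \<le> extended_integral M f"
    unfolding extended_integral_def
    using pos neg by (intro ereal_minus_mono) (simp_all add: less_eq_ennreal.rep_eq)
  finally show ?thesis
    using f neg fin(2) by (auto simp: extended_integral_exists_def intro: le_less_trans)
qed

lemma borel_measurable_lebesgue_on_AE:
  fixes f g :: "'a::euclidean_space \<Rightarrow> 'b::euclidean_space"
  assumes S: "S \<in> sets lebesgue" and f: "f \<in> borel_measurable (lebesgue_on S)"
    and ae: "AE x in lebesgue_on S. f x = g x"
  shows "g \<in> borel_measurable (lebesgue_on S)"
proof -
  have "(\<lambda>x. if x \<in> S then f x else 0) \<in> borel_measurable (lebesgue_on UNIV)"
    using f S by (subst borel_measurable_if_lebesgue_on) auto
  then have "(\<lambda>x. if x \<in> S then f x else 0) \<in> borel_measurable lebesgue"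
    by simp
  moreover have "AE x in lebesgue. x \<in> S \<longrightarrow> f x = g x"
    using ae S by (simp add: AE_restrict_space_iff)
  then have "AE x in lebesgue. (if x \<in> S then f x else 0) = (if x \<in> S then g x else 0)"
    by eventually_elim auto
  ultimately have "(\<lambda>x. if x \<in> S then g x else 0) \<in> borel_measurable lebesgue"
    by (rule borel_measurable_AE)
  then have "(\<lambda>x. if x \<in> S then g x else 0) \<in> borel_measurable (lebesgue_on UNIV)"
    by simp
  then show ?thesis
    using S by (subst (asm) borel_measurable_if_lebesgue_on) auto
qed

section \<open>The inequality\<close>

lemma convex_antimono_subgradient:
  fixes f :: "real \<Rightarrow> real"
  assumes "convex_on UNIV f" "antimono f"
  obtains m where "m \<le> 0" "\<And>y. f x + m * (y - x) \<le> f y"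
proof -
  define m where "m = Inf ((\<lambda>t. (f x - f t) / (x - t)) ` ({x<..} \<inter> UNIV))"
  have m: "f x + m * (y - x) \<le> f y" for y
    using convex_le_Inf_differential[OF assms(1), of x y] by (simp add: m_def)
  have "f (x + 1) \<le> f x"
    using assms(2) by (rule antimonoD) simp
  then have "m \<le> 0"
    using m[of "x + 1"] by simp
  then show thesis
    using that m by blast
qed

theorem theorem6p2:
  fixes g h :: "real ^ 'n \<Rightarrow> real"
    and p :: "real list \<Rightarrow> real"
    and \<Omega> :: "(real ^ 'n) set"
    and \<phi> :: "real ^ 'n \<Rightarrow> real ^ 'n"
    and w :: "real ^ 'n ^ 'n \<Rightarrow> real"
    and F :: "real ^ 'n ^ 'n"
  assumes g_cont: "continuous_on positive_orthant g"
    and g_sym: "symmetric_on_orthant g"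
    and h_def: "\<And>x. h x = g (\<chi> i. exp (x $ i))"
    and p_def: "\<And>x. p (partial_sums x) = h x"
    and h_convex: "convex_on UNIV h"
    and p_noninc: "nonincreasing_in_each_argument (range (partial_sums :: real ^ 'n \<Rightarrow> real list)) p"
    and "bounded \<Omega>" and "open \<Omega>" and "piecewise_smooth_boundary \<Omega>"
    and phi_lipschitz: "\<exists>L. L-lipschitz_on (closure \<Omega>) \<phi>"
    and phi_deriv: "AE x in lebesgue_on \<Omega>. \<phi> differentiable (at x) \<and> jacobian \<phi> (at x) \<in> GL_plus"
    and phi_boundary: "\<And>x. x \<in> frontier \<Omega> \<Longrightarrow> \<phi> x = x"
    and w_def: "\<And>A. A \<in> GL_plus \<Longrightarrow> w A = g (singular_values A)"
    and F: "F \<in> GL_plus"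
  shows "extended_integral_exists (lebesgue_on \<Omega>) (\<lambda>x. w (F ** jacobian \<phi> (at x))) \<and>
         extended_integral (lebesgue_on \<Omega>) (\<lambda>x. w (F ** jacobian \<phi> (at x)))
           \<ge> ereal (measure lebesgue \<Omega> * w F)"
proof -
  let ?M = "lebesgue_on \<Omega>"
  interpret log_stretch_energy h p
  proof
    show "h (\<chi> i. x $ \<pi> i) = h x" if "\<pi> permutes UNIV" for \<pi> x
    proof -
      let ?y = "\<chi> i. exp (x $ i)"
      have "?y \<in> positive_orthant"
        by (simp add: positive_orthant_def)
      then have "g (\<chi> i. ?y $ \<pi> i) = g ?y"
        using g_sym that unfolding symmetric_on_orthant_def by blast
      then show ?thesis by (simp add: h_def)
    qed
  qed (rule p_def h_convex p_noninc)+
  have w: "w A = profile (ln (det A))" if "A \<in> GL_plus" for A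
  proof -
    note sv = singular_values_pos_and_prod[OF that]
    have nz: "singular_values A $ i \<noteq> 0" for i
      using sv(1)[of i] by simp
    have "(\<chi> i. exp (ln (singular_values A $ i))) = singular_values A"
      using sv(1) by (simp add: vec_eq_iff)
    then have "w A = h (\<chi> i. ln (singular_values A $ i))"
      by (simp add: w_def[OF that] h_def)
    also have "\<dots> = profile (\<Sum>i\<in>UNIV. ln (singular_values A $ i))"
      by (simp add: h_eq_profile)
    also have "(\<Sum>i\<in>UNIV. ln (singular_values A $ i)) = ln (det A)"
      unfolding sv(2)[symmetric] by (rule ln_prod[symmetric]) (simp_all add: nz)
    finally show ?thesis .
  qed
  have prod_GL: "F ** A \<in> GL_plus" "ln (det (F ** A)) = ln (det F) + ln (det A)" if "A \<in> GL_plus" for A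
    using F that by (simp_all add: GL_plus_def det_mul ln_mult)
  obtain m where m: "m \<le> 0" "\<And>y. profile (ln (det F)) + m * (y - ln (det F)) \<le> profile y"
    using convex_antimono_subgradient[OF profile_convex profile_antimono] by blast
  have bound: "w F + m * (det A - 1) \<le> w (F ** A)" if A: "A \<in> GL_plus" for A
  proof -
    have "ln (det A) \<le> det A - 1"
      using A by (intro ln_le_minus_one) (simp add: GL_plus_def)
    then have "m * (det A - 1) \<le> m * ln (det A)"
      using m(1) by (rule mult_left_mono_neg)
    also have "profile (ln (det F)) + m * ln (det A) \<le> w (F ** A)"
      using m(2)[of "ln (det F) + ln (det A)"] by (simp add: w prod_GL A)
    ultimately show ?thesis
      by (simp add: w[OF F])
  qed
  define d where "d x = det (if \<phi> differentiable (at x) then jacobian \<phi> (at x) else mat 1)" for x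
  obtain L where L: "L-lipschitz_on (closure \<Omega>) \<phi>"
    using phi_lipschitz by blast
  have "AE x in ?M. \<phi> differentiable (at x)"
    using phi_deriv by eventually_elim simp
  then have d: "integrable ?M d" "(\<integral>x. d x \<partial>?M) = measure lebesgue \<Omega>"
    using integral_det_jacobian[OF \<open>bounded \<Omega>\<close> \<open>open \<Omega>\<close> L _ phi_boundary] unfolding d_def[abs_def] by blast+
  have d_jac: "AE x in ?M. jacobian \<phi> (at x) \<in> GL_plus \<and> d x = det (jacobian \<phi> (at x))"
    using phi_deriv by eventually_elim (simp add: d_def)
  have \<Omega>: "\<Omega> \<in> lmeasurable" "\<Omega> \<in> sets lebesgue"
    using \<open>bounded \<Omega>\<close> \<open>open \<Omega>\<close> by (auto intro: lmeasurable_open)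
  interpret finite_measure ?M
    using \<Omega>(1) by (rule finite_measure_lebesgue_on)
  have "continuous_on UNIV profile"
    using profile_convex by (rule convex_on_continuous[OF open_UNIV])
  then have "profile \<in> borel_measurable borel"
    by (rule borel_measurable_continuous_onI)
  moreover have "(\<lambda>x. ln (det F) + ln (d x)) \<in> borel_measurable ?M"
    using d(1) by (intro borel_measurable_add borel_measurable_const borel_measurable_ln) simp
  ultimately have "(\<lambda>x. profile (ln (det F) + ln (d x))) \<in> borel_measurable ?M"
    by (rule measurable_compose[rotated])
  moreover have "AE x in ?M. profile (ln (det F) + ln (d x)) = w (F ** jacobian \<phi> (at x))"
    using d_jac by eventually_elim (simp add: w prod_GL)
  ultimately have meas: "(\<lambda>x. w (F ** jacobian \<phi> (at x))) \<in> borel_measurable ?M"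
    by (rule borel_measurable_lebesgue_on_AE[OF \<Omega>(2)])
  have "integrable ?M (\<lambda>x. w F + m * (d x - 1))"
    using d(1) by (intro Bochner_Integration.integrable_add integrable_mult_right
        Bochner_Integration.integrable_diff integrable_const)
  moreover have "AE x in ?M. w F + m * (d x - 1) \<le> w (F ** jacobian \<phi> (at x))"
    using d_jac by eventually_elim (simp add: bound)
  ultimately have "extended_integral_exists ?M (\<lambda>x. w (F ** jacobian \<phi> (at x))) \<and>
      ereal (\<integral>x. w F + m * (d x - 1) \<partial>?M) \<le> extended_integral ?M (\<lambda>x. w (F ** jacobian \<phi> (at x)))"
    using meas by (intro extended_integral_ge_integral)
  moreover have "(\<integral>x. w F + m * (d x - 1) \<partial>?M) = measure lebesgue \<Omega> * w F"
    using d \<Omega> by (simp add: measure_restrict_space space_restrict_space)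
  ultimately show ?thesis by simp
qed

end
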